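(* Suppose that the spectral radius $\alpha(P)$ of the $N\times N$ matrix $P$ is strictly less than $1$. Let $\boldsymbol{\gamma}^0\in\boldsymbol{\Gamma}$ and define iterates $\boldsymbol{\gamma}^{k+1}=\mathsf{B}(\boldsymbol{\gamma}^k)$, $k\ge 0$. Then $\lim_{k\to\infty}\|\boldsymbol{\gamma}^k-\boldsymbol{\gamma}^*\|=0$, where $\boldsymbol{\gamma}^*$ is the unique fixed point of $\mathsf{B}$ in $\boldsymbol{\Gamma}$. Moreover, $\boldsymbol{\gamma}^*$ is the optimal regularized team decision rule, i.e. $J^{\mathsf{reg}}(\boldsymbol{\gamma}^* )=\sup_{\boldsymbol{\gamma}\in\boldsymbol{\Gamma}}J^{\mathsf{reg}}(\boldsymbol{\gamma})$.
   Context: Team model. There are $N$ agents. $\mathsf{X}$ is a Borel space (Borel subset of a complete separable metric space) with a Borel probability measure $\mathbb{P}$. For $i=1,\dots,N$, $\mathsf{U}_i$ and $\mathsf{Y}_i$ are nonempty finite sets (actions and observations of Agent $i$), and $W_i(\cdot\mid x,\mathbf{u}^{(1:i-1)})$ is a conditional probability (stochastic kernel) on $\mathsf{Y}_i$ given $\mathsf{X}\times\prod_{k=1}^{i-1}\mathsf{U}_k$. The reward function $p:\mathsf{X}\times\prod_i\mathsf{Y}_i\times\prod_i\mathsf{U}_i\to[0,\infty)$ is measurable. Put $\mathbf{y}=(y_1,\dots,y_N)$, $\mathbf{u}=(u_1,\dots,u_N)$, and a superscript $-j$ means that the $j$-th component is removed. Define $$r(\mathbf{y},\mathbf{u})=\int_{\mathsf{X}}p(x,\mathbf{y},\mathbf{u})\prod_{i=1}^N|\mathsf{Y}_i|\,W_i(y_i\mid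 x,\mathbf{u}^{(1:i-1)})\,\mathbb{P}(dx),$$ assumed finite, and let $\pi_i$ be the uniform distribution on $\mathsf{Y}_i$. $\Delta_i\subset\mathbb{R}^{\mathsf{U}_i}$ is the set of probability distributions on $\mathsf{U}_i$. A policy of Agent $i$ is a function $\gamma_i:\mathsf{Y}_i\to\Delta_i$, also written $\gamma_i(u_i\mid y_i)$. $\Gamma_i$ is the set of such policies, and $\boldsymbol{\Gamma}=\prod_{i=1}^N\Gamma_i$. For $\boldsymbol{\gamma}\in\boldsymbol{\Gamma}$ let $\boldsymbol{\gamma}(\mathbf{y})=(\gamma_1(y_1),\dots,\gamma_N(y_N))$. For $\boldsymbol{\delta}=(\delta_1,\dots,\delta_N)\in\prod_i\Delta_i$ let $R(\mathbf{y},\boldsymbol{\delta})=\sum_{\mathbf{u}}r(\mathbf{y},\mathbf{u})\prod_{i=1}^N\delta_i(u_i)$. Regularization. For each $i$, $\rho_i>0$ and $\Omega_i:\Delta_i\to\mathbb{R}$ is convex and $\rho_i$-strongly convex with respect to the $\ell_1$-norm $\|\cdot\|_1$ on $\mathbb{R}^{\mathsf{U}_i}$: extending $\Omega_i$ by $+\infty$ outside $\Delta_i$, for all $\delta,\delta'\in\Delta_i$ and every subgradient $z\in\partial\Omega_i(\delta)$, $\Omega_i(\delta')\ge\Omega_i(\delta)+\langle z,\delta'-\delta\rangle+\frac{\rho_i}{2}\|\delta'-\delta\|_1^2$. Put $R^{\mathsf{reg}}(\mathbf{y},\boldsymbol{\delta})=R(\mathbf{y},\boldsymbol{\delta})-\sum_{i=1}^N\Omega_i(\delta_i)$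 and $J^{\mathsf{reg}}(\boldsymbol{\gamma})=\sum_{\mathbf{y}}R^{\mathsf{reg}}(\mathbf{y},\boldsymbol{\gamma}(\mathbf{y}))\prod_{i=1}^N\pi_i(y_i)$. Best response. For each $j$, $\mathsf{B}_j$ maps $\boldsymbol{\gamma}^{-j}=(\gamma_i)_{i\ne j}$ to the policy in $\Gamma_j$ given by $$\mathsf{B}_j(\boldsymbol{\gamma}^{-j})(y_j)=\operatorname*{arg\,max}_{\delta_j\in\Delta_j}\Big[\sum_{\mathbf{y}^{-j}}R(\mathbf{y},\boldsymbol{\gamma}^{-j}(\mathbf{y}^{-j}),\delta_j)\prod_{i\ne j}\pi_i(y_i)-\Omega_j(\delta_j)\Big].$$ As a standing convention this maximizer exists and is unique, so $\mathsf{B}_j$ is single-valued. The best response operator $\mathsf{B}:\boldsymbol{\Gamma}\to\boldsymbol{\Gamma}$ is $\mathsf{B}(\boldsymbol{\gamma})=(\mathsf{B}_1(\boldsymbol{\gamma}^{-1}),\dots,\mathsf{B}_N(\boldsymbol{\gamma}^{-N}))$. Norms. $\|\gamma_i\|_{L_1}=\sum_{y_i}\|\gamma_i(\cdot\mid y_i)\|_1\,\pi_i(y_i)$ on $\mathbb{R}^{\mathsf{U}_i\times\mathsf{Y}_i}$, and $\|\boldsymbol{\gamma}\|=(\|\gamma_1\|_{L_1},\dots,\|\gamma_N\|_{L_1})^T$ is a vector in $\mathbb{R}^N$ (convergence to $0$ is componentwise). Matrix $P$. $\lambda_j(r)=\sup_{\mathbf{y},\mathbf{u}^{-j}}\big[\sup_{u_j}r(\mathbf{y},\mathbf{u})-\inf_{u_j}r(\mathbf{y},\mathbf{u})\big]$.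 $P(j,i)=\frac{1}{\rho_j}\frac{\lambda_i(r)}{2}$ for $i\ne j$ and $P(j,j)=0$. *)

theory Defs
  imports "HOL-Probability.Probability" "Jordan_Normal_Form.Spectral_Radius"
begin

text \<open>
  The \<open>N\<close> agents are numbered \<open>0, \<dots>, N - 1\<close>.  Agent \<open>i\<close> has the finite action set \<open>U i\<close> and the
  finite observation set \<open>Y i\<close>; joint actions and observations are elements of
  \<open>PiE {..<N} U\<close> and \<open>PiE {..<N} Y\<close>.  The space \<open>R^(U i)\<close> is represented by the real functions that
  vanish outside \<open>U i\<close>.
\<close>

definition vecs :: "'u set \<Rightarrow> ('u \<Rightarrow> real) set" where
  "vecs A = {v. \<forall>a. a \<notin> A \<longrightarrow> v a = 0}"

definition distributions :: "'u set \<Rightarrow> ('u \<Rightarrow> real) set" where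
  "distributions A = {\<delta> \<in> vecs A. (\<forall>a\<in>A. 0 \<le> \<delta> a) \<and> (\<Sum>a\<in>A. \<delta> a) = 1}"

definition l1_norm :: "'u set \<Rightarrow> ('u \<Rightarrow> real) \<Rightarrow> real" where
  "l1_norm A v = (\<Sum>a\<in>A. \<bar>v a\<bar>)"

subsection \<open>Regularizers\<close>

text \<open>The library predicate for convexity needs a real vector space type, which functions are not.\<close>

definition convex_on_distributions :: "'u set \<Rightarrow> (('u \<Rightarrow> real) \<Rightarrow> real) \<Rightarrow> bool" where
  "convex_on_distributions A \<Omega> \<longleftrightarrow>
     (\<forall>\<delta>\<in>distributions A. \<forall>\<delta>'\<in>distributions A. \<forall>t. 0 \<le> t \<and> t \<le> 1 \<longrightarrow>
        \<Omega> (\<lambda>a. (1 - t) * \<delta> a + t * \<delta>' a) \<le> (1 - t) * \<Omega> \<delta> + t * \<Omega> \<delta>')"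

definition extend :: "'u set \<Rightarrow> (('u \<Rightarrow> real) \<Rightarrow> real) \<Rightarrow> ('u \<Rightarrow> real) \<Rightarrow> ereal" where
  "extend A \<Omega> v = (if v \<in> distributions A then ereal (\<Omega> v) else \<infinity>)"

definition subdifferential ::
    "'u set \<Rightarrow> (('u \<Rightarrow> real) \<Rightarrow> ereal) \<Rightarrow> ('u \<Rightarrow> real) \<Rightarrow> ('u \<Rightarrow> real) set" where
  "subdifferential A F v =
     {z \<in> vecs A. \<forall>w\<in>vecs A. F v + ereal (\<Sum>a\<in>A. z a * (w a - v a)) \<le> F w}"

definition strongly_convex :: "'u set \<Rightarrow> real \<Rightarrow> (('u \<Rightarrow> real) \<Rightarrow> real) \<Rightarrow> bool" where
  "strongly_convex A \<rho> \<Omega> \<longleftrightarrow>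
     (\<forall>\<delta>\<in>distributions A. \<forall>\<delta>'\<in>distributions A. \<forall>z\<in>subdifferential A (extend A \<Omega>) \<delta>.
        \<Omega> \<delta>' \<ge> \<Omega> \<delta> + (\<Sum>a\<in>A. z a * (\<delta>' a - \<delta> a)) + \<rho> / 2 * (l1_norm A (\<lambda>a. \<delta>' a - \<delta> a))\<^sup>2)"

subsection \<open>Rewards\<close>

text \<open>
  In this section \<open>Q\<close> is the probability measure on the Borel space, and \<open>W i\<close> is the stochastic
  kernel of Agent \<open>i\<close>, applied to a pair of a state and a family of actions of the agents before \<open>i\<close>.
\<close>

definition reward_integrand ::
    "nat \<Rightarrow> (nat \<Rightarrow> 'y set) \<Rightarrow> (nat \<Rightarrow> 'x \<times> (nat \<Rightarrow> 'u) \<Rightarrow> 'y measure) \<Rightarrow>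
     ('x \<Rightarrow> (nat \<Rightarrow> 'y) \<Rightarrow> (nat \<Rightarrow> 'u) \<Rightarrow> real) \<Rightarrow> (nat \<Rightarrow> 'y) \<Rightarrow> (nat \<Rightarrow> 'u) \<Rightarrow> 'x \<Rightarrow> real" where
  "reward_integrand N Y W p y u x =
     p x y u * (\<Prod>i<N. real (card (Y i)) * measure (W i (x, restrict u {..<i})) {y i})"

definition reward ::
    "'x measure \<Rightarrow> nat \<Rightarrow> (nat \<Rightarrow> 'y set) \<Rightarrow> (nat \<Rightarrow> 'x \<times> (nat \<Rightarrow> 'u) \<Rightarrow> 'y measure) \<Rightarrow>
     ('x \<Rightarrow> (nat \<Rightarrow> 'y) \<Rightarrow> (nat \<Rightarrow> 'u) \<Rightarrow> real) \<Rightarrow> (nat \<Rightarrow> 'y) \<Rightarrow> (nat \<Rightarrow> 'u) \<Rightarrow> real" where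
  "reward Q N Y W p y u = (\<integral>x. reward_integrand N Y W p y u x \<partial>Q)"

definition mixed_reward ::
    "nat \<Rightarrow> (nat \<Rightarrow> 'u set) \<Rightarrow> ((nat \<Rightarrow> 'y) \<Rightarrow> (nat \<Rightarrow> 'u) \<Rightarrow> real) \<Rightarrow>
     (nat \<Rightarrow> 'y) \<Rightarrow> (nat \<Rightarrow> 'u \<Rightarrow> real) \<Rightarrow> real" where
  "mixed_reward N U r y \<delta> = (\<Sum>u\<in>PiE {..<N} U. r y u * (\<Prod>i<N. \<delta> i (u i)))"

subsection \<open>Policies and the regularized objective\<close>

definition policies :: "'u set \<Rightarrow> 'y set \<Rightarrow> ('y \<Rightarrow> 'u \<Rightarrow> real) set" where
  "policies A B = B \<rightarrow>\<^sub>E distributions A"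

definition profiles ::
    "nat set \<Rightarrow> (nat \<Rightarrow> 'u set) \<Rightarrow> (nat \<Rightarrow> 'y set) \<Rightarrow> (nat \<Rightarrow> 'y \<Rightarrow> 'u \<Rightarrow> real) set" where
  "profiles I U Y = (\<Pi>\<^sub>E i\<in>I. policies (U i) (Y i))"

definition J_reg ::
    "nat \<Rightarrow> (nat \<Rightarrow> 'u set) \<Rightarrow> (nat \<Rightarrow> 'y set) \<Rightarrow> ((nat \<Rightarrow> 'y) \<Rightarrow> (nat \<Rightarrow> 'u) \<Rightarrow> real) \<Rightarrow>
     (nat \<Rightarrow> ('u \<Rightarrow> real) \<Rightarrow> real) \<Rightarrow> (nat \<Rightarrow> 'y \<Rightarrow> 'u \<Rightarrow> real) \<Rightarrow> real" where
  "J_reg N U Y r \<Omega> \<gamma> =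
     (\<Sum>y\<in>PiE {..<N} Y. (mixed_reward N U r y (\<lambda>i. \<gamma> i (y i)) - (\<Sum>i<N. \<Omega> i (\<gamma> i (y i))))
        * (\<Prod>i<N. pmf (pmf_of_set (Y i)) (y i)))"

definition L1_norm :: "'u set \<Rightarrow> 'y set \<Rightarrow> ('y \<Rightarrow> 'u \<Rightarrow> real) \<Rightarrow> real" where
  "L1_norm A B g = (\<Sum>b\<in>B. l1_norm A (g b) * pmf (pmf_of_set B) b)"

subsection \<open>Best responses\<close>

text \<open>
  Here \<open>g\<close> is a policy profile of the agents other than \<open>j\<close>, and \<open>b\<close> is the observation of
  Agent \<open>j\<close>.
\<close>

definition response_objective ::
    "nat \<Rightarrow> (nat \<Rightarrow> 'u set) \<Rightarrow> (nat \<Rightarrow> 'y set) \<Rightarrow> ((nat \<Rightarrow> 'y) \<Rightarrow> (nat \<Rightarrow> 'u) \<Rightarrow> real) \<Rightarrow>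
     (nat \<Rightarrow> ('u \<Rightarrow> real) \<Rightarrow> real) \<Rightarrow> nat \<Rightarrow> (nat \<Rightarrow> 'y \<Rightarrow> 'u \<Rightarrow> real) \<Rightarrow> 'y \<Rightarrow> ('u \<Rightarrow> real) \<Rightarrow> real" where
  "response_objective N U Y r \<Omega> j g b \<delta> =
     (\<Sum>y\<in>PiE ({..<N} - {j}) Y.
        mixed_reward N U r (y(j := b)) ((\<lambda>i. g i (y i))(j := \<delta>))
          * (\<Prod>i\<in>{..<N} - {j}. pmf (pmf_of_set (Y i)) (y i)))
     - \<Omega> j \<delta>"

definition best_response ::
    "nat \<Rightarrow> (nat \<Rightarrow> 'u set) \<Rightarrow> (nat \<Rightarrow> 'y set) \<Rightarrow> ((nat \<Rightarrow> 'y) \<Rightarrow> (nat \<Rightarrow> 'u) \<Rightarrow> real) \<Rightarrow>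
     (nat \<Rightarrow> ('u \<Rightarrow> real) \<Rightarrow> real) \<Rightarrow> nat \<Rightarrow> (nat \<Rightarrow> 'y \<Rightarrow> 'u \<Rightarrow> real) \<Rightarrow> 'y \<Rightarrow> 'u \<Rightarrow> real" where
  "best_response N U Y r \<Omega> j g =
     (\<lambda>b\<in>Y j. arg_max (response_objective N U Y r \<Omega> j g b) (\<lambda>\<delta>. \<delta> \<in> distributions (U j)))"

definition best_response_operator ::
    "nat \<Rightarrow> (nat \<Rightarrow> 'u set) \<Rightarrow> (nat \<Rightarrow> 'y set) \<Rightarrow> ((nat \<Rightarrow> 'y) \<Rightarrow> (nat \<Rightarrow> 'u) \<Rightarrow> real) \<Rightarrow>
     (nat \<Rightarrow> ('u \<Rightarrow> real) \<Rightarrow> real) \<Rightarrow> (nat \<Rightarrow> 'y \<Rightarrow> 'u \<Rightarrow> real) \<Rightarrow> nat \<Rightarrow> 'y \<Rightarrow> 'u \<Rightarrow> real" where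
  "best_response_operator N U Y r \<Omega> \<gamma> =
     (\<lambda>j\<in>{..<N}. best_response N U Y r \<Omega> j (restrict \<gamma> ({..<N} - {j})))"

subsection \<open>The comparison matrix\<close>

definition oscillation ::
    "nat \<Rightarrow> (nat \<Rightarrow> 'u set) \<Rightarrow> (nat \<Rightarrow> 'y set) \<Rightarrow> ((nat \<Rightarrow> 'y) \<Rightarrow> (nat \<Rightarrow> 'u) \<Rightarrow> real) \<Rightarrow> nat \<Rightarrow> real" where
  "oscillation N U Y r j =
     (SUP (y, u)\<in>PiE {..<N} Y \<times> PiE ({..<N} - {j}) U.
        (SUP a\<in>U j. r y (u(j := a))) - (INF a\<in>U j. r y (u(j := a))))"

definition P_matrix ::
    "nat \<Rightarrow> (nat \<Rightarrow> 'u set) \<Rightarrow> (nat \<Rightarrow> 'y set) \<Rightarrow> ((nat \<Rightarrow> 'y) \<Rightarrow> (nat \<Rightarrow> 'u) \<Rightarrow> real) \<Rightarrow>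
     (nat \<Rightarrow> real) \<Rightarrow> complex mat" where
  "P_matrix N U Y r \<rho> =
     mat N N (\<lambda>(j, i). if i = j then 0
                        else complex_of_real (1 / \<rho> j * (oscillation N U Y r i / 2)))"

end

theory Submission
  imports Defs
begin

text \<open>
  The best response of an agent maximizes a linear function minus a strongly convex regularizer, so
  it is a Lipschitz function of the linear part (\<open>maximizer_lipschitz\<close>).  The linear part is an
  expected reward, and changing the policy of Agent \<open>i\<close> moves it by at most half the oscillation of
  the reward in the action of Agent \<open>i\<close> times the distance of the old and the new policy
  (\<open>expected_reward_lipschitz\<close>).  For the best response operator \<open>T\<close> this means that the
  vector of distances between \<open>T \<gamma>\<close> and \<open>T \<gamma>'\<close> is at most the comparison matrix \<open>P\<close> times the
  vector of distances between \<open>\<gamma>\<close> and \<open>\<gamma>'\<close> (\<open>best_response_lipschitz\<close>).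

  As \<open>P\<close> is nonnegative with spectral radius below 1, there are weights \<open>w \<ge> 1\<close> and \<open>\<beta> < 1\<close> with
  \<open>P w \<le> \<beta> w\<close> (\<open>subinvariant_weights\<close>).  In the maximum norm weighted by \<open>w\<close> the best response
  operator is a contraction by \<open>\<beta>\<close>; this gives the unique fixed point and the convergence of the
  iterates, as in Banach's theorem.

  For optimality it would be natural to take a maximizer of the team objective, which must be a fixed
  point.  But the regularizers are not assumed to be lower semicontinuous, so compactness does not
  give a maximizer.  Instead let the agents respond one after the other, starting from an arbitrary
  profile.  Each such step can only raise the objective (\<open>best_response_improves\<close>), and the same
  weights show that these sweeps converge to the fixed point too (\<open>sweep_contraction\<close>).  At the
  fixed point the objective is upper semicontinuous, because there each regularizer has a subgradient
  (\<open>J_upper_semicontinuous_at_fixed_point\<close>).  Hence the value at the fixed point is at least the value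
  at the starting profile (\<open>fixed_point_optimal\<close>).
\<close>

section \<open>Nonnegative matrices of spectral radius below one\<close>

text \<open>
A nonnegative matrix of spectral radius below 1 shrinks a suitable positive weight vector by a
uniform factor.  If the spectral radius is below \<open>s < t < 1\<close>, then the powers of
\<open>B = P / s\<close> are bounded.  The truncated Neumann sum
\<open>w = (\<Sum>k\<le>K. (s / t) ^ k B ^ k 1)\<close> satisfies \<open>P w = t (w - 1 + (s / t) ^ (K + 1) B ^ (K + 1) 1)\<close>,
and the bracket is at most \<open>w\<close> as soon as \<open>K\<close> is large.  Weights of this kind turn the vector of
distances between two policy profiles into a single quantity that contracts, and they work just as
well when the agents are updated one after the other.
\<close>

lemma subinvariant_weights:
  fixes p :: "nat \<Rightarrow> nat \<Rightarrow> real"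
  assumes n: "0 < n"
    and radius: "spectral_radius (mat n n (\<lambda>(j, i). complex_of_real (p j i))) < 1"
    and nonneg: "\<And>i j. i < n \<Longrightarrow> j < n \<Longrightarrow> 0 \<le> p j i"
  obtains w :: "nat \<Rightarrow> real" and \<beta> :: real
  where "0 < \<beta>" "\<beta> < 1" "\<And>i. i < n \<Longrightarrow> 1 \<le> w i"
    "\<And>j. j < n \<Longrightarrow> (\<Sum>i<n. p j i * w i) \<le> \<beta> * w j"
proof -
  let ?P = "mat n n (\<lambda>(j, i). complex_of_real (p j i))"
  have P: "?P \<in> carrier_mat n n" by simp
  obtain s where s: "spectral_radius ?P < s" "s < 1"
    using radius dense by blast
  have "0 \<le> spectral_radius ?P"
    using spectral_radius_mem_max(1)[OF P n] by auto
  then have s0: "0 < s" using s by linarith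
  define B where "B = mat n n (\<lambda>(j, i). complex_of_real (p j i / s))"
  have B: "B \<in> carrier_mat n n" unfolding B_def by simp
  have PB: "?P = complex_of_real s \<cdot>\<^sub>m B" unfolding B_def using s0 by auto
  have "spectral_radius B < 1"
  proof -
    obtain ev where ev: "ev \<in> spectrum B" "spectral_radius B = norm ev"
      using spectral_radius_mem_max(1)[OF B n] by auto
    then obtain v where "eigenvector B v ev"
      unfolding spectrum_def eigenvalue_def by auto
    then have v: "v \<in> carrier_vec n" "v \<noteq> 0\<^sub>v n" "B *\<^sub>v v = ev \<cdot>\<^sub>v v"
      using B unfolding eigenvector_def by auto
    have "?P *\<^sub>v v = complex_of_real s \<cdot>\<^sub>v (B *\<^sub>v v)"
      unfolding PB using B v(1) by (intro eq_vecI) auto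
    also have "\<dots> = (complex_of_real s * ev) \<cdot>\<^sub>v v"
      unfolding v(3) by (simp add: smult_smult_assoc)
    finally have "complex_of_real s * ev \<in> spectrum ?P"
      using v P unfolding spectrum_def eigenvalue_def eigenvector_def by auto
    then have "norm (complex_of_real s * ev) \<le> spectral_radius ?P"
      using spectral_radius_mem_max(2)[OF P n] by blast
    then have "s * norm ev \<le> spectral_radius ?P" using s0 by (simp add: norm_mult)
    then have "s * norm ev < s * 1" using s by linarith
    then show ?thesis using ev s0 by (metis mult_less_cancel_left_pos)
  qed
  then obtain c where c: "\<And>k. norm_bound (B ^\<^sub>m k) c"
    using spectral_radius_jnf_norm_bound_less_1_upper_triangular[OF B] by blast
  \<comment> \<open>\<open>T\<close> is \<open>B\<close> acting on real vectors, and \<open>b k = B ^ k 1\<close>.\<close>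
  define T where "T x = (\<lambda>j. \<Sum>i<n. p j i / s * x i)" for x :: "nat \<Rightarrow> real"
  define b where "b k = (T ^^ k) (\<lambda>_. 1)" for k
  have b_nonneg: "0 \<le> b k i" if "i < n" for k i
    using that
  proof (induction k arbitrary: i)
    case (Suc k)
    then show ?case
      using nonneg s0 by (auto simp: b_def T_def intro!: sum_nonneg mult_nonneg_nonneg)
  qed (simp add: b_def)
  have pow: "B ^\<^sub>m k *\<^sub>v vec n (\<lambda>i. complex_of_real (x i))
      = vec n (\<lambda>i. complex_of_real ((T ^^ k) x i))" for k and x :: "nat \<Rightarrow> real"
  proof (induction k arbitrary: x)
    case 0
    show ?case using B by simp
  next
    case (Suc k)
    have Bx: "B *\<^sub>v vec n (\<lambda>i. complex_of_real (x i)) = vec n (\<lambda>i. complex_of_real (T x i))"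
      by (intro eq_vecI) (auto simp: B_def T_def scalar_prod_def atLeast0LessThan)
    have "B ^\<^sub>m Suc k *\<^sub>v vec n (\<lambda>i. complex_of_real (x i))
        = B ^\<^sub>m k *\<^sub>v (B *\<^sub>v vec n (\<lambda>i. complex_of_real (x i)))"
      using B by (simp add: assoc_mult_mat_vec[OF pow_carrier_mat[OF B] B])
    also have "\<dots> = vec n (\<lambda>i. complex_of_real ((T ^^ k) (T x) i))"
      unfolding Bx by (rule Suc)
    finally show ?case by (simp add: funpow_swap1)
  qed
  have b_bound: "b k i \<le> n * c" if i: "i < n" for k i
  proof -
    have Bk: "dim_row (B ^\<^sub>m k) = n" "dim_col (B ^\<^sub>m k) = n"
      using pow_carrier_mat[OF B, of k] by auto
    have "complex_of_real (b k i) = vec_index (B ^\<^sub>m k *\<^sub>v vec n (\<lambda>i. complex_of_real 1)) i"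
      unfolding pow using i by (simp add: b_def)
    also have "\<dots> = (\<Sum>j<n. (B ^\<^sub>m k) $$ (i, j))"
      using i Bk
      by (auto simp: scalar_prod_def atLeast0LessThan simp del: pow_mat_dim intro!: sum.cong)
    finally have "b k i \<le> norm (\<Sum>j<n. (B ^\<^sub>m k) $$ (i, j))"
      by (metis abs_ge_self norm_of_real)
    also have "\<dots> \<le> (\<Sum>j<n. c)"
      using c[of k] i Bk
      by (intro order_trans[OF norm_sum] sum_mono) (simp add: norm_bound_def del: pow_mat_dim)
    finally show ?thesis by simp
  qed
  obtain t where t: "s < t" "t < 1" using s(2) dense by blast
  have "(\<lambda>K. (s / t) ^ K * (n * c)) \<longlonglongrightarrow> 0 * (n * c)"
    using s0 t by (intro tendsto_intros LIMSEQ_power_zero) auto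
  then have "eventually (\<lambda>K. (s / t) ^ K * (n * c) < 1) sequentially"
    by (rule order_tendstoD(2)) simp
  then obtain K where "(s / t) ^ K * (n * c) < 1"
    by (metis eventually_sequentially order_refl)
  then have K: "(s / t) ^ Suc K * (n * c) \<le> 1"
  proof -
    assume a: "(s / t) ^ K * (n * c) < 1"
    have "0 \<le> n * c" using b_nonneg[OF n, of 0] b_bound[OF n, of 0] by linarith
    moreover have "(s / t) ^ Suc K \<le> (s / t) ^ K"
      using s0 t by (intro power_decreasing) auto
    ultimately have "(s / t) ^ Suc K * (n * c) \<le> (s / t) ^ K * (n * c)"
      by (rule mult_right_mono[rotated])
    with a show ?thesis by linarith
  qed
  define w where "w i = (\<Sum>k\<le>K. (s / t) ^ k * b k i)" for i
  have w1: "1 \<le> w i" if "i < n" for i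
  proof -
    have "(\<Sum>k\<in>{0}. (s / t) ^ k * b k i) \<le> w i"
      unfolding w_def using s0 t b_nonneg that by (intro sum_mono2) auto
    then show ?thesis by (simp add: b_def)
  qed
  have "(\<Sum>i<n. p j i * w i) \<le> t * w j" if j: "j < n" for j
  proof -
    have "(\<Sum>i<n. p j i * w i) = (\<Sum>k\<le>K. (s / t) ^ k * (\<Sum>i<n. p j i * b k i))"
      unfolding w_def sum_distrib_left
      by (subst sum.swap) (auto simp: ac_simps intro!: sum.cong)
    also have "\<dots> = (\<Sum>k\<le>K. t * ((s / t) ^ Suc k * b (Suc k) j))"
    proof (intro sum.cong refl)
      fix k
      have "s * b (Suc k) j = (\<Sum>i<n. p j i * b k i)"
        using s0 by (simp add: b_def T_def sum_distrib_left)
      then show "(s / t) ^ k * (\<Sum>i<n. p j i * b k i) = t * ((s / t) ^ Suc k * b (Suc k) j)"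
        using s0 t by (simp add: field_simps)
    qed
    \<comment> \<open>The shifted sum lacks the term \<open>k = 0\<close>, which is \<open>b 0 = 1\<close>.\<close>
    also have "\<dots> = t * ((\<Sum>k\<le>Suc K. (s / t) ^ k * b k j) - 1)"
      by (subst sum.atMost_Suc_shift) (simp add: sum_distrib_left b_def)
    also have "\<dots> = t * (w j + ((s / t) ^ Suc K * b (Suc K) j - 1))"
      unfolding w_def by simp
    also have "\<dots> \<le> t * w j"
    proof -
      have "(s / t) ^ Suc K * b (Suc K) j \<le> (s / t) ^ Suc K * (n * c)"
        using s0 t b_bound[OF j] by (intro mult_left_mono) auto
      with K have "(s / t) ^ Suc K * b (Suc K) j - 1 \<le> 0" by linarith
      then show ?thesis using s0 t by (intro mult_left_mono) auto
    qed
    finally show ?thesis .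
  qed
  then show ?thesis
    using that[of t w] s0 t w1 by simp
qed

section \<open>Expected rewards under independent randomization\<close>

lemma sum_PiE_insert:
  assumes "k \<notin> K"
  shows "(\<Sum>f\<in>PiE (insert k K) A. h f) = (\<Sum>a\<in>A k. \<Sum>f\<in>PiE K A. h (f(k := a)))"
proof -
  have "(\<Sum>f\<in>PiE (insert k K) A. h f) = (\<Sum>(a, f)\<in>A k \<times> PiE K A. h (f(k := a)))"
    unfolding PiE_insert_eq
    by (subst sum.reindex) (auto simp: inj_combinator[OF assms] case_prod_beta)
  then show ?thesis by (simp add: sum.cartesian_product)
qed

lemma sum_pmf_of_set:
  assumes "finite B" "B \<noteq> {}"
  shows "(\<Sum>b\<in>B. pmf (pmf_of_set B) b) = 1"
  using assms by (intro sum_pmf_eq_1) auto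

text \<open>
As \<open>v\<close> has total mass zero, \<open>c\<close> may be shifted by a constant; centring it at the midpoint of its
range makes all its values at most \<open>L / 2\<close> in absolute value.  The factor 1/2 in the comparison
matrix comes from here.
\<close>

lemma sum_oscillation_bound:
  fixes v c :: "'a \<Rightarrow> real"
  assumes "finite A" and "(\<Sum>a\<in>A. v a) = 0"
    and osc: "\<And>a a'. a \<in> A \<Longrightarrow> a' \<in> A \<Longrightarrow> c a - c a' \<le> L"
  shows "\<bar>\<Sum>a\<in>A. v a * c a\<bar> \<le> L / 2 * (\<Sum>a\<in>A. \<bar>v a\<bar>)"
proof (cases "A = {}")
  case False
  define m where "m = (Max (c ` A) + Min (c ` A)) / 2"
  have "Max (c ` A) \<in> c ` A" "Min (c ` A) \<in> c ` A" using assms(1) False by auto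
  then have width: "Max (c ` A) - Min (c ` A) \<le> L" using osc by force
  have m: "\<bar>c a - m\<bar> \<le> L / 2" if "a \<in> A" for a
  proof -
    have "c a \<le> Max (c ` A)" "Min (c ` A) \<le> c a" using assms(1) that by auto
    moreover have "2 * m = Max (c ` A) + Min (c ` A)" unfolding m_def by simp
    ultimately show ?thesis using width by linarith
  qed
  have "(\<Sum>a\<in>A. v a * c a) = (\<Sum>a\<in>A. v a * (c a - m))"
    using assms(2) by (simp add: algebra_simps sum_subtractf flip: sum_distrib_left)
  also have "\<bar>\<dots>\<bar> \<le> (\<Sum>a\<in>A. \<bar>v a\<bar> * (L / 2))"
    unfolding abs_mult by (intro order_trans[OF sum_abs] sum_mono, unfold abs_mult)
       (intro mult_left_mono m, auto)
  also have "\<dots> = L / 2 * (\<Sum>a\<in>A. \<bar>v a\<bar>)"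
    by (simp add: sum_distrib_left mult.commute)
  finally show ?thesis .
qed simp

text \<open>
The observations and actions of the agents in \<open>K\<close> are drawn independently: Agent \<open>i\<close> observes a
uniformly distributed \<open>y i\<close> and then acts according to \<open>g i (y i)\<close>.  The set \<open>K\<close> is a parameter so
that the agents can be added one at a time by induction.
\<close>

definition expected_reward ::
    "nat set \<Rightarrow> (nat \<Rightarrow> 'u set) \<Rightarrow> (nat \<Rightarrow> 'y set) \<Rightarrow> ((nat \<Rightarrow> 'y) \<Rightarrow> (nat \<Rightarrow> 'u) \<Rightarrow> real) \<Rightarrow>
     (nat \<Rightarrow> 'y \<Rightarrow> 'u \<Rightarrow> real) \<Rightarrow> real" where
  "expected_reward K U Y f g =
     (\<Sum>y\<in>PiE K Y. \<Sum>u\<in>PiE K U. f y u * (\<Prod>i\<in>K. pmf (pmf_of_set (Y i)) (y i) * g i (y i) (u i)))"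

lemma expected_reward_insert:
  assumes "finite K" "k \<notin> K"
  shows "expected_reward (insert k K) U Y f g =
    (\<Sum>b\<in>Y k. pmf (pmf_of_set (Y k)) b * (\<Sum>a\<in>U k. g k b a *
       expected_reward K U Y (\<lambda>y u. f (y(k := b)) (u(k := a))) g))"
proof -
  have "expected_reward (insert k K) U Y f g =
      (\<Sum>b\<in>Y k. \<Sum>y\<in>PiE K Y. \<Sum>a\<in>U k. \<Sum>u\<in>PiE K U. f (y(k := b)) (u(k := a)) *
         (pmf (pmf_of_set (Y k)) b * g k b a *
          (\<Prod>i\<in>K. pmf (pmf_of_set (Y i)) (y i) * g i (y i) (u i))))"
  proof -
    have "(\<Prod>i\<in>K. pmf (pmf_of_set (Y i)) ((y(k := b)) i) * g i ((y(k := b)) i) ((u(k := a)) i))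
       = (\<Prod>i\<in>K. pmf (pmf_of_set (Y i)) (y i) * g i (y i) (u i))"
      for y :: "nat \<Rightarrow> 'b" and b u a
      using assms by (intro prod.cong) auto
    then have "(\<Prod>i\<in>insert k K. pmf (pmf_of_set (Y i)) ((y(k := b)) i) * g i ((y(k := b)) i) ((u(k := a)) i))
       = pmf (pmf_of_set (Y k)) b * g k b a * (\<Prod>i\<in>K. pmf (pmf_of_set (Y i)) (y i) * g i (y i) (u i))"
      for y :: "nat \<Rightarrow> 'b" and b u a
      unfolding prod.insert[OF assms] by simp
    then show ?thesis
      unfolding expected_reward_def sum_PiE_insert[OF assms(2)] by simp
  qed
  also have "\<dots> = (\<Sum>b\<in>Y k. \<Sum>a\<in>U k. \<Sum>y\<in>PiE K Y. \<Sum>u\<in>PiE K U. f (y(k := b)) (u(k := a)) *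
         (pmf (pmf_of_set (Y k)) b * g k b a *
          (\<Prod>i\<in>K. pmf (pmf_of_set (Y i)) (y i) * g i (y i) (u i))))"
    by (intro sum.cong refl sum.swap)
  also have "\<dots> = (\<Sum>b\<in>Y k. pmf (pmf_of_set (Y k)) b * (\<Sum>a\<in>U k. g k b a *
       expected_reward K U Y (\<lambda>y u. f (y(k := b)) (u(k := a))) g))"
    unfolding expected_reward_def sum_distrib_left by (simp add: ac_simps)
  finally show ?thesis .
qed

lemma expected_reward_one:
  assumes "finite K"
    and "\<And>i. i \<in> K \<Longrightarrow> finite (U i)" "\<And>i. i \<in> K \<Longrightarrow> finite (Y i) \<and> Y i \<noteq> {}"
    and "\<And>i b. i \<in> K \<Longrightarrow> b \<in> Y i \<Longrightarrow> g i b \<in> distributions (U i)"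
  shows "expected_reward K U Y (\<lambda>y u. c) g = c"
  using assms
proof (induction K rule: finite_induct)
  case (insert k K)
  have "(\<Sum>b\<in>Y k. pmf (pmf_of_set (Y k)) b * (\<Sum>a\<in>U k. g k b a * c)) =
      (\<Sum>b\<in>Y k. pmf (pmf_of_set (Y k)) b * c)"
    using insert.prems
    by (intro sum.cong refl) (auto simp: distributions_def simp flip: sum_distrib_right)
  with insert show ?case
    by (simp add: expected_reward_insert sum_pmf_of_set flip: sum_distrib_right)
qed (simp add: expected_reward_def)

lemma expected_reward_diff:
  "expected_reward K U Y f g - expected_reward K U Y f' g
     = expected_reward K U Y (\<lambda>y u. f y u - f' y u) g"
  by (simp add: expected_reward_def sum_subtractf left_diff_distrib)

lemma expected_reward_le:
  assumes "finite K"
    and "\<And>i. i \<in> K \<Longrightarrow> finite (U i)" "\<And>i. i \<in> K \<Longrightarrow> finite (Y i) \<and> Y i \<noteq> {}"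
    and "\<And>i b. i \<in> K \<Longrightarrow> b \<in> Y i \<Longrightarrow> g i b \<in> distributions (U i)"
    and "\<And>y u. y \<in> PiE K Y \<Longrightarrow> u \<in> PiE K U \<Longrightarrow> f y u \<le> c"
  shows "expected_reward K U Y f g \<le> c"
proof -
  have "expected_reward K U Y f g \<le> expected_reward K U Y (\<lambda>y u. c) g"
    unfolding expected_reward_def using assms(4,5)
    by (intro sum_mono mult_right_mono prod_nonneg)
       (auto simp: distributions_def PiE_mem intro!: mult_nonneg_nonneg)
  also have "\<dots> = c" by (intro expected_reward_one assms(1-4))
  finally show ?thesis .
qed

text \<open>
Switching from \<open>g\<close> to \<open>g'\<close> one agent at a time, the switch of Agent \<open>i\<close> pairs a difference of two
distributions, which has mass zero, with an average of rewards, which oscillates by at most \<open>L i\<close>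
in the action of Agent \<open>i\<close>.  Thus each switch costs \<open>L i / 2\<close> times the distance of the two policies.
The induction on \<open>K\<close> carries out this telescoping.
\<close>

lemma expected_reward_lipschitz:
  assumes "finite K"
    and "\<And>i. i \<in> K \<Longrightarrow> finite (U i)" "\<And>i. i \<in> K \<Longrightarrow> finite (Y i) \<and> Y i \<noteq> {}"
    and "\<And>i b. i \<in> K \<Longrightarrow> b \<in> Y i \<Longrightarrow> g i b \<in> distributions (U i)"
    and "\<And>i b. i \<in> K \<Longrightarrow> b \<in> Y i \<Longrightarrow> g' i b \<in> distributions (U i)"
    and "\<And>i y u a a'. i \<in> K \<Longrightarrow> y \<in> PiE K Y \<Longrightarrow> u \<in> PiE K U \<Longrightarrow> a \<in> U i \<Longrightarrow> a' \<in> U i \<Longrightarrow>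
           f y (u(i := a)) - f y (u(i := a')) \<le> L i"
  shows "\<bar>expected_reward K U Y f g - expected_reward K U Y f g'\<bar>
           \<le> (\<Sum>i\<in>K. L i / 2 * L1_norm (U i) (Y i) (\<lambda>b a. g i b a - g' i b a))"
  using assms
proof (induction K arbitrary: f rule: finite_induct)
  case empty
  show ?case by (simp add: expected_reward_def)
next
  case (insert k K)
  note U = insert.prems(1) and Y = insert.prems(2) and g = insert.prems(3)
    and g' = insert.prems(4) and osc = insert.prems(5)
  let ?\<pi> = "\<lambda>b. pmf (pmf_of_set (Y k)) b"
  \<comment> \<open>\<open>F b a\<close> is the reward of the remaining agents once Agent \<open>k\<close> has seen \<open>b\<close> and played \<open>a\<close>.\<close>
  define F where "F b a = (\<lambda>y u. f (y(k := b)) (u(k := a)))" for b a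
  define S where "S = (\<Sum>i\<in>K. L i / 2 * L1_norm (U i) (Y i) (\<lambda>b a. g i b a - g' i b a))"
  have IH: "\<bar>expected_reward K U Y (F b a) g - expected_reward K U Y (F b a) g'\<bar> \<le> S"
    if "b \<in> Y k" "a \<in> U k" for b a
    unfolding S_def
  proof (rule insert.IH)
    fix i y u c c'
    assume i: "i \<in> K" and yu: "y \<in> PiE K Y" "u \<in> PiE K U" and c: "c \<in> U i" "c' \<in> U i"
    have "i \<noteq> k" using i insert.hyps by auto
    then show "F b a y (u(i := c)) - F b a y (u(i := c')) \<le> L i"
      using osc[OF insertI2[OF i] PiE_fun_upd[OF that(1) yu(1)] PiE_fun_upd[OF that(2) yu(2)] c]
      unfolding F_def by (simp only: fun_upd_twist)
  qed (rule U Y g g'; simp)+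
  have osc_k: "expected_reward K U Y (F b a) g' - expected_reward K U Y (F b a') g' \<le> L k"
    if "b \<in> Y k" "a \<in> U k" "a' \<in> U k" for b a a'
    unfolding expected_reward_diff
  proof (rule expected_reward_le[OF insert.hyps(1)])
    fix y u assume yu: "y \<in> PiE K Y" "u \<in> PiE K U"
    show "F b a y u - F b a' y u \<le> L k"
      using osc[OF insertI1 PiE_fun_upd[OF that(1) yu(1)] PiE_fun_upd[OF that(2) yu(2)] that(2,3)]
      unfolding F_def by (simp only: fun_upd_upd)
  qed (rule U Y g'; simp)+
  \<comment> \<open>First the agents in \<open>K\<close> switch to \<open>g'\<close>, then Agent \<open>k\<close>.\<close>
  have split: "expected_reward (insert k K) U Y f g - expected_reward (insert k K) U Y f g'
      = (\<Sum>b\<in>Y k. ?\<pi> b * (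
          (\<Sum>a\<in>U k. g k b a * (expected_reward K U Y (F b a) g - expected_reward K U Y (F b a) g'))
        + (\<Sum>a\<in>U k. (g k b a - g' k b a) * expected_reward K U Y (F b a) g')))"
    unfolding expected_reward_insert[OF insert.hyps] F_def
    by (simp add: algebra_simps sum_subtractf sum.distrib)
  have "\<bar>expected_reward (insert k K) U Y f g - expected_reward (insert k K) U Y f g'\<bar>
      \<le> (\<Sum>b\<in>Y k. ?\<pi> b * (S + L k / 2 * l1_norm (U k) (\<lambda>a. g k b a - g' k b a)))"
    unfolding split
  proof (intro order_trans[OF sum_abs] sum_mono)
    fix b assume b: "b \<in> Y k"
    have gb: "g k b \<in> distributions (U k)" "g' k b \<in> distributions (U k)"
      using g g' b by auto
    have "\<bar>\<Sum>a\<in>U k. g k b a * (expected_reward K U Y (F b a) g - expected_reward K U Y (F b a) g')\<bar>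
        \<le> (\<Sum>a\<in>U k. g k b a * S)"
      using gb IH[OF b]
      by (intro order_trans[OF sum_abs] sum_mono)
         (auto simp: abs_mult distributions_def intro!: mult_left_mono)
    also have "\<dots> = S"
      using gb by (simp add: distributions_def flip: sum_distrib_right)
    finally have 1: "\<bar>\<Sum>a\<in>U k. g k b a *
        (expected_reward K U Y (F b a) g - expected_reward K U Y (F b a) g')\<bar> \<le> S" .
    have 2: "\<bar>\<Sum>a\<in>U k. (g k b a - g' k b a) * expected_reward K U Y (F b a) g'\<bar>
        \<le> L k / 2 * (\<Sum>a\<in>U k. \<bar>g k b a - g' k b a\<bar>)"
      using gb U osc_k[OF b]
      by (intro sum_oscillation_bound) (auto simp: distributions_def sum_subtractf)
    show "\<bar>?\<pi> b * (
          (\<Sum>a\<in>U k. g k b a * (expected_reward K U Y (F b a) g - expected_reward K U Y (F b a) g'))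
        + (\<Sum>a\<in>U k. (g k b a - g' k b a) * expected_reward K U Y (F b a) g'))\<bar>
        \<le> ?\<pi> b * (S + L k / 2 * l1_norm (U k) (\<lambda>a. g k b a - g' k b a))"
      unfolding abs_mult abs_of_nonneg[OF pmf_nonneg] l1_norm_def
      using order_trans[OF abs_triangle_ineq add_mono[OF 1 2]]
      by (intro mult_left_mono) auto
  qed
  also have "\<dots> = S + L k / 2 * L1_norm (U k) (Y k) (\<lambda>b a. g k b a - g' k b a)"
  proof -
    have "(\<Sum>b\<in>Y k. ?\<pi> b * (S + L k / 2 * l1_norm (U k) (\<lambda>a. g k b a - g' k b a)))
        = (\<Sum>b\<in>Y k. ?\<pi> b) * S + L k / 2 * L1_norm (U k) (Y k) (\<lambda>b a. g k b a - g' k b a)"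
      unfolding L1_norm_def sum_distrib_left sum_distrib_right sum.distrib[symmetric]
      by (intro sum.cong refl) (simp only: algebra_simps)
    moreover have "(\<Sum>b\<in>Y k. ?\<pi> b) = 1"
      using Y[OF insertI1] by (intro sum_pmf_of_set) auto
    ultimately show ?thesis by simp
  qed
  also have "\<dots> = (\<Sum>i\<in>insert k K. L i / 2 * L1_norm (U i) (Y i) (\<lambda>b a. g i b a - g' i b a))"
    using insert.hyps by (simp add: S_def)
  finally show ?case .
qed

section \<open>Maximizers of linear functions minus strongly convex regularizers\<close>

text \<open>
Maximality of \<open>\<delta>\<close> for \<open>l - \<Omega>\<close> is, after rearranging, the subgradient inequality.  Strong convexity is
an assumption about existing subgradients only, so this is what makes it applicable to best
responses, even on the boundary of the simplex.
\<close>

lemma maximizer_subgradient: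
  assumes "\<delta> \<in> distributions A"
    and max: "\<And>\<eta>. \<eta> \<in> distributions A \<Longrightarrow> (\<Sum>a\<in>A. l a * \<eta> a) - \<Omega> \<eta> \<le> (\<Sum>a\<in>A. l a * \<delta> a) - \<Omega> \<delta>"
  shows "(\<lambda>a. if a \<in> A then l a else 0) \<in> subdifferential A (extend A \<Omega>) \<delta>"
proof -
  have "extend A \<Omega> \<delta> + ereal (\<Sum>a\<in>A. (if a \<in> A then l a else 0) * (\<eta> a - \<delta> a)) \<le> extend A \<Omega> \<eta>" for \<eta>
  proof (cases "\<eta> \<in> distributions A")
    case True
    have "(\<Sum>a\<in>A. (if a \<in> A then l a else 0) * (\<eta> a - \<delta> a))
        = (\<Sum>a\<in>A. l a * \<eta> a) - (\<Sum>a\<in>A. l a * \<delta> a)"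
      unfolding sum_subtractf[symmetric] by (intro sum.cong refl) (simp add: algebra_simps)
    then show ?thesis using True assms(1) max[OF True] by (simp add: extend_def)
  qed (simp add: extend_def)
  then show ?thesis by (auto simp: subdifferential_def vecs_def)
qed

text \<open>
Adding the strong convexity inequalities at \<open>\<delta>\<close> and at \<open>\<delta>'\<close> cancels \<open>\<Omega>\<close> and leaves
\<open>\<rho> \<parallel>\<delta> - \<delta>'\<parallel>\<^sup>2 \<le> \<langle>l - l', \<delta> - \<delta>'\<rangle>\<close>, whose right-hand side is at most \<open>M \<parallel>\<delta> - \<delta>'\<parallel>\<close> by duality of
the maximum norm and the \<open>l1\<close>-norm.
\<close>

lemma maximizer_lipschitz:
  assumes "finite A" "0 < \<rho>" "strongly_convex A \<rho> \<Omega>"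
    and d: "\<delta> \<in> distributions A" "\<delta>' \<in> distributions A"
    and max: "\<And>\<eta>. \<eta> \<in> distributions A \<Longrightarrow> (\<Sum>a\<in>A. l a * \<eta> a) - \<Omega> \<eta> \<le> (\<Sum>a\<in>A. l a * \<delta> a) - \<Omega> \<delta>"
    and max': "\<And>\<eta>. \<eta> \<in> distributions A \<Longrightarrow> (\<Sum>a\<in>A. l' a * \<eta> a) - \<Omega> \<eta> \<le> (\<Sum>a\<in>A. l' a * \<delta>' a) - \<Omega> \<delta>'"
    and close: "\<And>a. a \<in> A \<Longrightarrow> \<bar>l a - l' a\<bar> \<le> M" and "0 \<le> M"
  shows "l1_norm A (\<lambda>a. \<delta> a - \<delta>' a) \<le> M / \<rho>"
proof -
  let ?n = "l1_norm A (\<lambda>a. \<delta> a - \<delta>' a)"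
  have n': "l1_norm A (\<lambda>a. \<delta>' a - \<delta> a) = ?n"
    unfolding l1_norm_def by (simp add: abs_minus_commute)
  have "\<Omega> \<delta>' \<ge> \<Omega> \<delta> + (\<Sum>a\<in>A. l a * (\<delta>' a - \<delta> a)) + \<rho> / 2 * ?n\<^sup>2"
    using assms(3) d maximizer_subgradient[where l = l and \<Omega> = \<Omega>, OF d(1) max]
    unfolding strongly_convex_def n'[symmetric] by fastforce
  moreover have "\<Omega> \<delta> \<ge> \<Omega> \<delta>' + (\<Sum>a\<in>A. l' a * (\<delta> a - \<delta>' a)) + \<rho> / 2 * ?n\<^sup>2"
    using assms(3) d maximizer_subgradient[where l = l' and \<Omega> = \<Omega>, OF d(2) max']
    unfolding strongly_convex_def by fastforce
  moreover have "(\<Sum>a\<in>A. l a * (\<delta>' a - \<delta> a)) + (\<Sum>a\<in>A. l' a * (\<delta> a - \<delta>' a))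
      = - (\<Sum>a\<in>A. (l a - l' a) * (\<delta> a - \<delta>' a))"
    unfolding sum.distrib[symmetric] sum_negf[symmetric]
    by (intro sum.cong refl) (simp add: algebra_simps)
  ultimately have "\<rho> * ?n\<^sup>2 \<le> (\<Sum>a\<in>A. (l a - l' a) * (\<delta> a - \<delta>' a))"
    by argo
  also have "\<dots> \<le> (\<Sum>a\<in>A. M * \<bar>\<delta> a - \<delta>' a\<bar>)"
  proof (rule sum_mono)
    fix a assume "a \<in> A"
    have "(l a - l' a) * (\<delta> a - \<delta>' a) \<le> \<bar>l a - l' a\<bar> * \<bar>\<delta> a - \<delta>' a\<bar>"
      by (metis abs_ge_self abs_mult)
    also have "\<dots> \<le> M * \<bar>\<delta> a - \<delta>' a\<bar>"
      using close[OF \<open>a \<in> A\<close>] by (intro mult_right_mono) auto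
    finally show "(l a - l' a) * (\<delta> a - \<delta>' a) \<le> M * \<bar>\<delta> a - \<delta>' a\<bar>" .
  qed
  also have "\<dots> = M * ?n" by (simp add: l1_norm_def sum_distrib_left)
  finally have "(\<rho> * ?n) * ?n \<le> M * ?n" by (simp add: power2_eq_square)
  moreover have "0 \<le> ?n" unfolding l1_norm_def by (intro sum_nonneg) auto
  ultimately have "\<rho> * ?n \<le> M"
    using \<open>0 \<le> M\<close> by (cases "?n = 0") (auto simp: mult_le_cancel_right)
  then show ?thesis using \<open>0 < \<rho>\<close> by (simp add: field_simps)
qed

section \<open>Response objectives and reward oscillation\<close>

lemma expected_reward_cong:
  assumes "\<And>i. i \<in> K \<Longrightarrow> g i = g' i"
  shows "expected_reward K U Y f g = expected_reward K U Y f g'"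
  unfolding expected_reward_def using assms by (intro sum.cong refl arg_cong2[where f = "(*)"] prod.cong) auto

lemma mixed_reward_insert:
  assumes "j < N"
  shows "mixed_reward N U r y (d(j := \<delta>)) =
    (\<Sum>a\<in>U j. \<Sum>u\<in>PiE ({..<N} - {j}) U. r y (u(j := a)) * (\<delta> a * (\<Prod>i\<in>{..<N} - {j}. d i (u i))))"
proof -
  have ins: "{..<N} = insert j ({..<N} - {j})" using assms by auto
  have "(\<Prod>i<N. (d(j := \<delta>)) i ((u(j := a)) i)) = \<delta> a * (\<Prod>i\<in>{..<N} - {j}. d i (u i))" for u a
    using assms by (subst prod.remove[where x = j]) (auto intro!: prod.cong)
  then show ?thesis
    unfolding mixed_reward_def
    by (subst (1) ins, subst sum_PiE_insert) simp_all
qed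

text \<open>
Up to the regularizer the objective of a best response is linear in \<open>\<delta>\<close>; the coefficient of action
\<open>a\<close> is the expected reward of playing \<open>a\<close> after observing \<open>b\<close>.
\<close>

lemma response_objective_linear:
  assumes "j < N"
  shows "response_objective N U Y r \<Omega> j g b \<delta> =
    (\<Sum>a\<in>U j. expected_reward ({..<N} - {j}) U Y (\<lambda>y u. r (y(j := b)) (u(j := a))) g * \<delta> a) - \<Omega> j \<delta>"
proof -
  let ?K = "{..<N} - {j}"
  have "(\<Sum>y\<in>PiE ?K Y. mixed_reward N U r (y(j := b)) ((\<lambda>i. g i (y i))(j := \<delta>))
          * (\<Prod>i\<in>?K. pmf (pmf_of_set (Y i)) (y i)))
      = (\<Sum>y\<in>PiE ?K Y. \<Sum>a\<in>U j. \<Sum>u\<in>PiE ?K U. r (y(j := b)) (u(j := a)) *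
          (\<Prod>i\<in>?K. pmf (pmf_of_set (Y i)) (y i) * g i (y i) (u i)) * \<delta> a)"
    unfolding mixed_reward_insert[OF assms] sum_distrib_right prod.distrib
    by (intro sum.cong refl) (simp only: mult_ac)
  also have "\<dots> = (\<Sum>a\<in>U j. \<Sum>y\<in>PiE ?K Y. \<Sum>u\<in>PiE ?K U. r (y(j := b)) (u(j := a)) *
          (\<Prod>i\<in>?K. pmf (pmf_of_set (Y i)) (y i) * g i (y i) (u i)) * \<delta> a)"
    by (rule sum.swap)
  finally show ?thesis
    unfolding response_objective_def expected_reward_def sum_distrib_right by simp
qed

lemma response_objective_restrict:
  assumes "j < N"
  shows "response_objective N U Y r \<Omega> j (restrict g ({..<N} - {j})) b \<delta> = response_objective N U Y r \<Omega> j g b \<delta>"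
proof -
  have "expected_reward ({..<N} - {j}) U Y f (restrict g ({..<N} - {j}))
      = expected_reward ({..<N} - {j}) U Y f g" for f
    by (rule expected_reward_cong) simp
  then show ?thesis unfolding response_objective_linear[OF assms] by (simp only:)
qed

lemma reward_difference_le_oscillation:
  assumes fin: "\<And>i. i < N \<Longrightarrow> finite (U i)" "\<And>i. i < N \<Longrightarrow> finite (Y i)"
    and "i < N" "y \<in> PiE {..<N} Y" "u \<in> PiE ({..<N} - {i}) U" "a \<in> U i" "a' \<in> U i"
  shows "r y (u(i := a)) - r y (u(i := a')) \<le> oscillation N U Y r i"
proof -
  let ?f = "\<lambda>(y, u). (SUP a\<in>U i. r y (u(i := a))) - (INF a\<in>U i. r y (u(i := a)))"
  have "r y (u(i := a)) \<le> (SUP a\<in>U i. r y (u(i := a)))"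
    using fin assms by (intro cSUP_upper) auto
  moreover have "(INF a\<in>U i. r y (u(i := a))) \<le> r y (u(i := a'))"
    using fin assms by (intro cINF_lower) auto
  ultimately have "r y (u(i := a)) - r y (u(i := a')) \<le> ?f (y, u)" by simp
  also have "\<dots> \<le> oscillation N U Y r i"
    unfolding oscillation_def using fin assms
    by (intro cSUP_upper bdd_above_finite finite_imageI finite_cartesian_product finite_PiE) auto
  finally show ?thesis .
qed

section \<open>Best responses depend Lipschitz continuously on the profile\<close>

locale regularized_team =
  fixes N :: nat and U :: "nat \<Rightarrow> 'u set" and Y :: "nat \<Rightarrow> 'y set"
    and r :: "(nat \<Rightarrow> 'y) \<Rightarrow> (nat \<Rightarrow> 'u) \<Rightarrow> real"
    and \<rho> :: "nat \<Rightarrow> real" and \<Omega> :: "nat \<Rightarrow> ('u \<Rightarrow> real) \<Rightarrow> real"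
  assumes actions: "i < N \<Longrightarrow> finite (U i) \<and> U i \<noteq> {}"
    and observations: "i < N \<Longrightarrow> finite (Y i) \<and> Y i \<noteq> {}"
    and rho_pos: "i < N \<Longrightarrow> 0 < \<rho> i"
    and regularizer: "i < N \<Longrightarrow> strongly_convex (U i) (\<rho> i) (\<Omega> i)"
    and maximizer_exists: "j < N \<Longrightarrow> g \<in> profiles ({..<N} - {j}) U Y \<Longrightarrow> b \<in> Y j \<Longrightarrow>
      \<exists>\<delta>. is_arg_max (response_objective N U Y r \<Omega> j g b) (\<lambda>\<delta>. \<delta> \<in> distributions (U j)) \<delta>"
begin

abbreviation "\<Gamma> \<equiv> profiles {..<N} U Y"
abbreviation "T \<equiv> best_response_operator N U Y r \<Omega>"
abbreviation "J \<equiv> J_reg N U Y r \<Omega>"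
abbreviation "d i \<gamma> \<gamma>' \<equiv> L1_norm (U i) (Y i) (\<lambda>b a. \<gamma> i b a - \<gamma>' i b a)"

definition marginal :: "nat \<Rightarrow> (nat \<Rightarrow> 'y \<Rightarrow> 'u \<Rightarrow> real) \<Rightarrow> 'y \<Rightarrow> 'u \<Rightarrow> real" where
  "marginal j \<gamma> b a = expected_reward ({..<N} - {j}) U Y (\<lambda>y u. r (y(j := b)) (u(j := a))) \<gamma>"

text \<open>
The real entries of the comparison matrix.
\<close>

definition influence :: "nat \<Rightarrow> nat \<Rightarrow> real" where
  "influence j i = (if i = j then 0 else 1 / \<rho> j * (oscillation N U Y r i / 2))"

lemma profile_distribution:
  assumes "\<gamma> \<in> \<Gamma>" "i < N" "b \<in> Y i"
  shows "\<gamma> i b \<in> distributions (U i)"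
  using assms unfolding profiles_def policies_def by (auto dest!: PiE_mem)

lemma profile_restrict: "\<gamma> \<in> \<Gamma> \<Longrightarrow> restrict \<gamma> ({..<N} - {j}) \<in> profiles ({..<N} - {j}) U Y"
  unfolding profiles_def by auto

lemma profile_update:
  assumes "\<gamma> \<in> \<Gamma>" "\<gamma>' \<in> \<Gamma>" "j < N"
  shows "\<gamma>(j := \<gamma>' j) \<in> \<Gamma>"
  using assms unfolding profiles_def by (auto simp: PiE_iff extensional_def)

lemma response_objective_marginal:
  "j < N \<Longrightarrow> response_objective N U Y r \<Omega> j \<gamma> b \<delta> = (\<Sum>a\<in>U j. marginal j \<gamma> b a * \<delta> a) - \<Omega> j \<delta>"
  unfolding marginal_def by (rule response_objective_linear)

lemma best_response_maximizes:
  assumes "\<gamma> \<in> \<Gamma>" "j < N" "b \<in> Y j"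
  shows "T \<gamma> j b \<in> distributions (U j)"
    and "\<eta> \<in> distributions (U j) \<Longrightarrow>
      response_objective N U Y r \<Omega> j \<gamma> b \<eta> \<le> response_objective N U Y r \<Omega> j \<gamma> b (T \<gamma> j b)"
proof -
  let ?g = "restrict \<gamma> ({..<N} - {j})"
  let ?P = "is_arg_max (response_objective N U Y r \<Omega> j ?g b) (\<lambda>\<delta>. \<delta> \<in> distributions (U j))"
  have T: "T \<gamma> j b = (SOME \<delta>. ?P \<delta>)"
    using assms by (simp add: best_response_operator_def best_response_def arg_max_def)
  have "?P (T \<gamma> j b)"
    unfolding T using maximizer_exists[OF assms(2) profile_restrict[OF assms(1)] assms(3)]
    by (rule someI_ex)
  then show "T \<gamma> j b \<in> distributions (U j)"
    and "\<eta> \<in> distributions (U j) \<Longrightarrow>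
      response_objective N U Y r \<Omega> j \<gamma> b \<eta> \<le> response_objective N U Y r \<Omega> j \<gamma> b (T \<gamma> j b)"
    unfolding is_arg_max_linorder response_objective_restrict[OF assms(2)] by auto
qed

lemma best_response_marginal:
  assumes "\<gamma> \<in> \<Gamma>" "j < N" "b \<in> Y j" "\<eta> \<in> distributions (U j)"
  shows "(\<Sum>a\<in>U j. marginal j \<gamma> b a * \<eta> a) - \<Omega> j \<eta>
    \<le> (\<Sum>a\<in>U j. marginal j \<gamma> b a * T \<gamma> j b a) - \<Omega> j (T \<gamma> j b)"
  using best_response_maximizes(2)[OF assms] unfolding response_objective_marginal[OF assms(2)] .

lemma best_response_profile:
  assumes "\<gamma> \<in> \<Gamma>"
  shows "T \<gamma> \<in> \<Gamma>"
proof -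
  have "T \<gamma> j b \<in> distributions (U j)" if "j < N" "b \<in> Y j" for j b
    using best_response_maximizes(1)[OF assms that] .
  moreover have "T \<gamma> \<in> extensional {..<N}" unfolding best_response_operator_def by simp
  moreover have "T \<gamma> j \<in> extensional (Y j)" if "j < N" for j
    using that by (simp add: best_response_operator_def best_response_def)
  ultimately show ?thesis
    unfolding profiles_def policies_def by (auto simp: PiE_iff)
qed

lemma iterate_profile: "\<gamma> \<in> \<Gamma> \<Longrightarrow> (T ^^ k) \<gamma> \<in> \<Gamma>"
  by (induction k) (auto intro: best_response_profile)

lemma d_nonneg: "0 \<le> d i \<gamma> \<gamma>'"
  unfolding L1_norm_def l1_norm_def by (intro sum_nonneg mult_nonneg_nonneg) auto

lemma oscillation_nonneg:
  assumes "i < N"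
  shows "0 \<le> oscillation N U Y r i"
proof -
  have "PiE {..<N} Y \<noteq> {}" "PiE ({..<N} - {i}) U \<noteq> {}" "U i \<noteq> {}"
    using actions observations assms by (auto simp: PiE_eq_empty_iff)
  then obtain y u a where "y \<in> PiE {..<N} Y" "u \<in> PiE ({..<N} - {i}) U" "a \<in> U i"
    by blast
  then show ?thesis
    using reward_difference_le_oscillation[of N U Y i y u a a r] actions observations assms by auto
qed

lemma influence_nonneg: "i < N \<Longrightarrow> j < N \<Longrightarrow> 0 \<le> influence j i"
  using oscillation_nonneg[of i] rho_pos[of j] by (auto simp: influence_def)

lemma marginal_lipschitz:
  assumes "\<gamma> \<in> \<Gamma>" "\<gamma>' \<in> \<Gamma>" "j < N" "b \<in> Y j" "a \<in> U j"
  shows "\<bar>marginal j \<gamma> b a - marginal j \<gamma>' b a\<bar>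
    \<le> (\<Sum>i\<in>{..<N} - {j}. oscillation N U Y r i / 2 * d i \<gamma> \<gamma>')"
  unfolding marginal_def
proof (rule expected_reward_lipschitz)
  fix i y u c c'
  assume i: "i \<in> {..<N} - {j}" and y: "y \<in> PiE ({..<N} - {j}) Y" and u: "u \<in> PiE ({..<N} - {j}) U"
    and c: "c \<in> U i" "c' \<in> U i"
  have ins: "insert j ({..<N} - {j}) = {..<N}" using assms(3) by auto
  have y': "y(j := b) \<in> PiE {..<N} Y"
    using PiE_fun_upd[OF assms(4) y] unfolding ins .
  have u': "restrict (u(j := a)) ({..<N} - {i}) \<in> PiE ({..<N} - {i}) U"
    using PiE_fun_upd[OF assms(5) u] unfolding ins by auto
  have "r (y(j := b)) ((restrict (u(j := a)) ({..<N} - {i}))(i := c))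
      - r (y(j := b)) ((restrict (u(j := a)) ({..<N} - {i}))(i := c')) \<le> oscillation N U Y r i"
    using i c actions observations by (intro reward_difference_le_oscillation y' u') auto
  moreover have "(restrict (u(j := a)) ({..<N} - {i}))(i := c) = u(i := c, j := a)" for c
  proof
    fix k
    have "u k = undefined" if "\<not> k < N" using u that by (auto simp: PiE_iff extensional_def)
    then show "((restrict (u(j := a)) ({..<N} - {i}))(i := c)) k = (u(i := c, j := a)) k"
      using i assms(3) by auto
  qed
  ultimately show "r (y(j := b)) (u(i := c, j := a)) - r (y(j := b)) (u(i := c', j := a))
      \<le> oscillation N U Y r i"
    by simp
qed (use actions observations profile_distribution assms in auto)

text \<open>
This is where the comparison matrix comes from: the objective of Agent \<open>j\<close> changes by at most the
half-oscillations times the distances of the other policies, and the maximizer by this amount over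
\<open>\<rho> j\<close>.
\<close>

lemma best_response_lipschitz:
  assumes "\<gamma> \<in> \<Gamma>" "\<gamma>' \<in> \<Gamma>" "j < N"
  shows "d j (T \<gamma>) (T \<gamma>') \<le> (\<Sum>i<N. influence j i * d i \<gamma> \<gamma>')"
proof -
  define M where "M = (\<Sum>i\<in>{..<N} - {j}. oscillation N U Y r i / 2 * d i \<gamma> \<gamma>')"
  have M: "M / \<rho> j = (\<Sum>i<N. influence j i * d i \<gamma> \<gamma>')"
    using assms(3) by (simp add: M_def influence_def sum.remove[of "{..<N}" j] sum_divide_distrib mult.commute)
  have "0 \<le> M"
    unfolding M_def by (intro sum_nonneg mult_nonneg_nonneg d_nonneg) (auto simp: oscillation_nonneg)
  have "l1_norm (U j) (\<lambda>a. T \<gamma> j b a - T \<gamma>' j b a) \<le> M / \<rho> j" if b: "b \<in> Y j" for b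
  proof (rule maximizer_lipschitz)
    show "\<bar>marginal j \<gamma> b a - marginal j \<gamma>' b a\<bar> \<le> M" if "a \<in> U j" for a
      unfolding M_def by (rule marginal_lipschitz[OF assms b that])
    show "strongly_convex (U j) (\<rho> j) (\<Omega> j)" "0 < \<rho> j" "finite (U j)" "0 \<le> M"
      using regularizer rho_pos actions assms(3) \<open>0 \<le> M\<close> by auto
  qed (intro best_response_maximizes(1) best_response_marginal assms b; assumption)+
  then have "d j (T \<gamma>) (T \<gamma>') \<le> (\<Sum>b\<in>Y j. M / \<rho> j * pmf (pmf_of_set (Y j)) b)"
    unfolding L1_norm_def by (intro sum_mono mult_right_mono) auto
  also have "\<dots> = M / \<rho> j"
    using observations[OF assms(3)] sum_pmf_of_set[of "Y j"] by (simp only: flip: sum_distrib_left) simp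
  finally show ?thesis unfolding M .
qed

lemma d_le_2:
  assumes "\<gamma> \<in> \<Gamma>" "\<gamma>' \<in> \<Gamma>" "i < N"
  shows "d i \<gamma> \<gamma>' \<le> 2"
proof -
  have "l1_norm (U i) (\<lambda>a. \<gamma> i b a - \<gamma>' i b a) \<le> 2" if "b \<in> Y i" for b
  proof -
    note D = profile_distribution[OF assms(1,3) that] profile_distribution[OF assms(2,3) that]
    have "l1_norm (U i) (\<lambda>a. \<gamma> i b a - \<gamma>' i b a) \<le> (\<Sum>a\<in>U i. \<gamma> i b a + \<gamma>' i b a)"
      unfolding l1_norm_def using D by (intro sum_mono) (fastforce simp: distributions_def)
    also have "\<dots> = 2" using D by (simp add: distributions_def sum.distrib)
    finally show ?thesis .
  qed
  then have "d i \<gamma> \<gamma>' \<le> (\<Sum>b\<in>Y i. 2 * pmf (pmf_of_set (Y i)) b)"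
    unfolding L1_norm_def by (intro sum_mono mult_right_mono) auto
  also have "\<dots> = 2"
    using observations[OF assms(3)] sum_pmf_of_set[of "Y i"] by (simp only: flip: sum_distrib_left) simp
  finally show ?thesis .
qed

lemma coordinate_le_d:
  assumes "i < N" "b \<in> Y i" "a \<in> U i"
  shows "\<bar>\<gamma> i b a - \<gamma>' i b a\<bar> \<le> real (card (Y i)) * d i \<gamma> \<gamma>'"
proof -
  have Y: "finite (Y i)" "Y i \<noteq> {}" "finite (U i)" using observations actions assms(1) by auto
  then have card: "0 < real (card (Y i))" by (simp add: card_gt_0_iff)
  have "\<bar>\<gamma> i b a - \<gamma>' i b a\<bar> \<le> l1_norm (U i) (\<lambda>a. \<gamma> i b a - \<gamma>' i b a)"
    unfolding l1_norm_def using Y assms(3)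
    by (intro member_le_sum[where f = "\<lambda>a. \<bar>\<gamma> i b a - \<gamma>' i b a\<bar>"]) auto
  also have "\<dots> = real (card (Y i)) * (l1_norm (U i) (\<lambda>a. \<gamma> i b a - \<gamma>' i b a) * pmf (pmf_of_set (Y i)) b)"
    using Y card assms(2) by simp
  also have "\<dots> \<le> real (card (Y i)) * d i \<gamma> \<gamma>'"
    unfolding L1_norm_def using Y assms(2)
    by (intro mult_left_mono member_le_sum[where f = "\<lambda>b. l1_norm (U i) (\<lambda>a. \<gamma> i b a - \<gamma>' i b a) * pmf (pmf_of_set (Y i)) b"])
       (auto simp: l1_norm_def intro!: sum_nonneg)
  finally show ?thesis .
qed

lemma d_tendsto_0_imp_pointwise:
  assumes "\<And>i. i < N \<Longrightarrow> (\<lambda>k. d i (x k) \<gamma>) \<longlonglongrightarrow> 0" and "i < N" "b \<in> Y i" "a \<in> U i"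
  shows "(\<lambda>k. x k i b a) \<longlonglongrightarrow> \<gamma> i b a"
proof -
  have "(\<lambda>k. real (card (Y i)) * d i (x k) \<gamma>) \<longlonglongrightarrow> 0"
    using tendsto_mult_right_zero[OF assms(1)[OF assms(2)]] .
  then have "(\<lambda>k. x k i b a - \<gamma> i b a) \<longlonglongrightarrow> 0"
    by (rule Lim_null_comparison[rotated]) (simp add: coordinate_le_d assms)
  then show ?thesis by (simp add: LIM_zero_iff)
qed

lemma profile_eqI:
  assumes "\<gamma> \<in> \<Gamma>" "\<gamma>' \<in> \<Gamma>"
    and "\<And>i b a. i < N \<Longrightarrow> b \<in> Y i \<Longrightarrow> a \<in> U i \<Longrightarrow> \<gamma> i b a = \<gamma>' i b a"
  shows "\<gamma> = \<gamma>'"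
proof -
  have "\<gamma> i b = \<gamma>' i b" if "i < N" "b \<in> Y i" for i b
  proof
    fix a show "\<gamma> i b a = \<gamma>' i b a"
      using assms(3)[OF that] profile_distribution[OF assms(1) that] profile_distribution[OF assms(2) that]
      by (cases "a \<in> U i") (auto simp: distributions_def vecs_def)
  qed
  moreover have "\<gamma> \<in> extensional {..<N}" "\<gamma>' \<in> extensional {..<N}"
      "i < N \<Longrightarrow> \<gamma> i \<in> extensional (Y i)" "i < N \<Longrightarrow> \<gamma>' i \<in> extensional (Y i)" for i
    using assms(1,2) unfolding profiles_def policies_def by (auto simp: PiE_iff)
  ultimately show ?thesis
    by (intro extensionalityI[of _ "{..<N}"] extensionalityI[of "\<gamma> _" "Y _"]) auto
qed


subsection \<open>The team objective under unilateral best responses\<close>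

text \<open>
Splitting off the observation of Agent \<open>j\<close> shows that, as a function of the policy of Agent \<open>j\<close>
alone, the team objective is the average of the best response objectives minus a constant.  In
particular a unilateral best response cannot lower it.
\<close>

lemma J_reg_update:
  assumes "j < N"
  shows "J (\<gamma>(j := g)) =
    (\<Sum>b\<in>Y j. pmf (pmf_of_set (Y j)) b * response_objective N U Y r \<Omega> j \<gamma> b (g b))
    - (\<Sum>y\<in>PiE ({..<N} - {j}) Y. (\<Sum>i\<in>{..<N} - {j}. \<Omega> i (\<gamma> i (y i)))
         * (\<Prod>i\<in>{..<N} - {j}. pmf (pmf_of_set (Y i)) (y i)))"
proof -
  let ?K = "{..<N} - {j}"
  let ?\<pi> = "\<lambda>y. \<Prod>i\<in>?K. pmf (pmf_of_set (Y i)) (y i)"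
  let ?m = "\<lambda>b y. mixed_reward N U r (y(j := b)) ((\<lambda>i. \<gamma> i (y i))(j := g b))"
  let ?C = "\<Sum>y\<in>PiE ?K Y. (\<Sum>i\<in>?K. \<Omega> i (\<gamma> i (y i))) * ?\<pi> y"
  have ins: "{..<N} = insert j ?K" using assms by auto
  have K: "finite ?K" "j \<notin> ?K" by auto
  have total: "(\<Sum>y\<in>PiE ?K Y. ?\<pi> y) = 1"
    using observations by (subst prod_sum_PiE[symmetric]) (auto simp: sum_pmf_of_set)
  have summand: "(mixed_reward N U r (y(j := b)) (\<lambda>i. (\<gamma>(j := g)) i ((y(j := b)) i))
        - (\<Sum>i<N. \<Omega> i ((\<gamma>(j := g)) i ((y(j := b)) i)))) * (\<Prod>i<N. pmf (pmf_of_set (Y i)) ((y(j := b)) i))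
      = pmf (pmf_of_set (Y j)) b * (?m b y * ?\<pi> y - \<Omega> j (g b) * ?\<pi> y
          - (\<Sum>i\<in>?K. \<Omega> i (\<gamma> i (y i))) * ?\<pi> y)" for y b
  proof -
    have "(\<lambda>i. (\<gamma>(j := g)) i ((y(j := b)) i)) = (\<lambda>i. \<gamma> i (y i))(j := g b)" by auto
    moreover have "(\<Sum>i<N. \<Omega> i ((\<gamma>(j := g)) i ((y(j := b)) i)))
        = \<Omega> j (g b) + (\<Sum>i\<in>?K. \<Omega> i (\<gamma> i (y i)))"
      using assms by (subst sum.remove[where x = j]) (auto intro!: sum.cong)
    moreover have "(\<Prod>i<N. pmf (pmf_of_set (Y i)) ((y(j := b)) i)) = pmf (pmf_of_set (Y j)) b * ?\<pi> y"
      using assms by (subst prod.remove[where x = j]) (auto intro!: prod.cong)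
    moreover have "(m - (o1 + o2)) * (q * p) = q * (m * p - o1 * p - o2 * p)" for m o1 o2 q p :: real
      by (simp add: algebra_simps)
    ultimately show ?thesis by (simp only:)
  qed
  have "J (\<gamma>(j := g)) = (\<Sum>b\<in>Y j. \<Sum>y\<in>PiE ?K Y. pmf (pmf_of_set (Y j)) b *
      (?m b y * ?\<pi> y - \<Omega> j (g b) * ?\<pi> y - (\<Sum>i\<in>?K. \<Omega> i (\<gamma> i (y i))) * ?\<pi> y))"
    unfolding J_reg_def summand[symmetric] by (subst (1) ins, subst sum_PiE_insert[OF K(2)]) (rule refl)
  also have "\<dots> = (\<Sum>b\<in>Y j. pmf (pmf_of_set (Y j)) b *
      ((\<Sum>y\<in>PiE ?K Y. ?m b y * ?\<pi> y) - \<Omega> j (g b) * (\<Sum>y\<in>PiE ?K Y. ?\<pi> y) - ?C))"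
    unfolding sum_distrib_left[symmetric] sum_subtractf ..
  also have "\<dots> = (\<Sum>b\<in>Y j. pmf (pmf_of_set (Y j)) b * response_objective N U Y r \<Omega> j \<gamma> b (g b))
      - (\<Sum>b\<in>Y j. pmf (pmf_of_set (Y j)) b) * ?C"
    unfolding total response_objective_def sum_distrib_right sum_subtractf[symmetric]
    by (intro sum.cong refl) (simp only: right_diff_distrib mult_1_right)
  also have "(\<Sum>b\<in>Y j. pmf (pmf_of_set (Y j)) b) = 1"
    using observations[OF assms] by (intro sum_pmf_of_set) auto
  finally show ?thesis by (simp only: mult_1_left)
qed

lemma best_response_improves:
  assumes "\<gamma> \<in> \<Gamma>" "j < N"
  shows "J \<gamma> \<le> J (\<gamma>(j := T \<gamma> j))"
proof -
  have "J (\<gamma>(j := \<gamma> j)) \<le> J (\<gamma>(j := T \<gamma> j))"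
    unfolding J_reg_update[OF assms(2)]
    by (intro diff_right_mono sum_mono mult_left_mono best_response_maximizes(2)[OF assms]
        profile_distribution[OF assms]) auto
  then show ?thesis by simp
qed

text \<open>
Simultaneous best responses may lower the team objective, since every agent reacts to policies that
the others are abandoning at the same moment.  In a sweep the agents respond one after the other,
each to the current policies, so that the objective never decreases.
\<close>

primrec sweep :: "nat \<Rightarrow> (nat \<Rightarrow> 'y \<Rightarrow> 'u \<Rightarrow> real) \<Rightarrow> nat \<Rightarrow> 'y \<Rightarrow> 'u \<Rightarrow> real" where
  "sweep 0 \<gamma> = \<gamma>"
| "sweep (Suc m) \<gamma> = (sweep m \<gamma>)(m := T (sweep m \<gamma>) m)"

lemma sweep_profile: "\<gamma> \<in> \<Gamma> \<Longrightarrow> m \<le> N \<Longrightarrow> sweep m \<gamma> \<in> \<Gamma>"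
proof (induction m)
  case (Suc m)
  then have "sweep m \<gamma> \<in> \<Gamma>" "m < N" by auto
  then show ?case
    unfolding sweep.simps by (intro profile_update best_response_profile)
qed simp

lemma sweep_improves: "\<gamma> \<in> \<Gamma> \<Longrightarrow> m \<le> N \<Longrightarrow> J \<gamma> \<le> J (sweep m \<gamma>)"
proof (induction m)
  case (Suc m)
  then have "sweep m \<gamma> \<in> \<Gamma>" "m < N" "J \<gamma> \<le> J (sweep m \<gamma>)" by (auto simp: sweep_profile)
  then show ?case
    unfolding sweep.simps using best_response_improves order_trans by blast
qed simp

text \<open>
The regularizers may be discontinuous on the boundary of the simplex, so \<open>J\<close> need not be upper
semicontinuous everywhere.  At a fixed point, however, each policy is a best response, and its
maximality bounds \<open>\<Omega> i\<close> from below by an affine function that touches it there.  Replacing \<open>\<Omega> i\<close>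
by this minorant \<open>low\<close> gives a continuous majorant \<open>up\<close> of \<open>J\<close> with the same value at \<open>\<gamma>\<close>.
\<close>

lemma J_upper_semicontinuous_at_fixed_point:
  assumes "\<gamma> \<in> \<Gamma>" "T \<gamma> = \<gamma>" "\<And>k. x k \<in> \<Gamma>"
    and d0: "\<And>i. i < N \<Longrightarrow> (\<lambda>k. d i (x k) \<gamma>) \<longlonglongrightarrow> 0"
    and c: "\<And>k. c \<le> J (x k)"
  shows "c \<le> J \<gamma>"
proof -
  note lim = d_tendsto_0_imp_pointwise[OF d0]
  let ?\<pi> = "\<lambda>y. \<Prod>i<N. pmf (pmf_of_set (Y i)) (y i)"
  define low where "low i b \<delta> = \<Omega> i (\<gamma> i b) + (\<Sum>a\<in>U i. marginal i \<gamma> b a * (\<delta> a - \<gamma> i b a))"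
    for i b \<delta>
  have low: "low i b \<delta> \<le> \<Omega> i \<delta>" if "i < N" "b \<in> Y i" "\<delta> \<in> distributions (U i)" for i b \<delta>
    using best_response_marginal[OF assms(1) that] unfolding assms(2) low_def
    by (simp add: right_diff_distrib sum_subtractf)
  define up where "up \<gamma>' = (\<Sum>y\<in>PiE {..<N} Y.
      (mixed_reward N U r y (\<lambda>i. \<gamma>' i (y i)) - (\<Sum>i<N. low i (y i) (\<gamma>' i (y i)))) * ?\<pi> y)" for \<gamma>'
  have "c \<le> up (x k)" for k
  proof -
    have "J (x k) \<le> up (x k)"
      unfolding J_reg_def up_def
      by (intro sum_mono mult_right_mono diff_left_mono low profile_distribution[OF assms(3)] prod_nonneg)
         auto
    with c[of k] show ?thesis by linarith
  qed
  moreover have "(\<lambda>k. up (x k)) \<longlonglongrightarrow> up \<gamma>"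
    unfolding up_def low_def mixed_reward_def
    by (intro tendsto_intros lim) (auto simp: PiE_mem)
  ultimately have "c \<le> up \<gamma>" by (intro LIMSEQ_le_const) auto
  also have "up \<gamma> = J \<gamma>" unfolding up_def low_def J_reg_def by simp
  finally show ?thesis .
qed

end

section \<open>The unique fixed point and its optimality\<close>

text \<open>
Under these weights the quantity \<open>Max {d i \<gamma> \<gamma>' / w i}\<close> is the metric in which best responses
contract.  It appears below only through bounds of the form \<open>d i \<gamma> \<gamma>' \<le> c * w i\<close>.
\<close>

locale contractive_team = regularized_team +
  fixes w :: "nat \<Rightarrow> real" and \<beta> :: real
  assumes beta: "0 < \<beta>" "\<beta> < 1"
    and weight: "i < N \<Longrightarrow> 1 \<le> w i"
    and influence_weight: "j < N \<Longrightarrow> (\<Sum>i<N. influence j i * w i) \<le> \<beta> * w j"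
begin

lemma best_response_contraction:
  assumes "\<gamma> \<in> \<Gamma>" "\<gamma>' \<in> \<Gamma>" "0 \<le> c" "\<And>i. i < N \<Longrightarrow> d i \<gamma> \<gamma>' \<le> c * w i" "j < N"
  shows "d j (T \<gamma>) (T \<gamma>') \<le> \<beta> * c * w j"
proof -
  have "d j (T \<gamma>) (T \<gamma>') \<le> (\<Sum>i<N. influence j i * d i \<gamma> \<gamma>')"
    using assms by (intro best_response_lipschitz)
  also have "\<dots> \<le> (\<Sum>i<N. influence j i * (c * w i))"
    using assms influence_nonneg by (intro sum_mono mult_left_mono) auto
  also have "\<dots> = c * (\<Sum>i<N. influence j i * w i)"
    by (simp add: sum_distrib_left ac_simps)
  also have "\<dots> \<le> c * (\<beta> * w j)"
    using assms influence_weight by (intro mult_left_mono) auto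
  finally show ?thesis by (simp add: ac_simps)
qed

lemma d_le_weight:
  assumes "\<gamma> \<in> \<Gamma>" "\<gamma>' \<in> \<Gamma>" "i < N"
  shows "d i \<gamma> \<gamma>' \<le> 2 * w i"
  using d_le_2[OF assms] weight[OF assms(3)] by linarith

lemma iterates_contract:
  assumes "\<gamma> \<in> \<Gamma>" "\<gamma>' \<in> \<Gamma>" "i < N"
  shows "d i ((T ^^ k) \<gamma>) ((T ^^ k) \<gamma>') \<le> \<beta> ^ k * 2 * w i"
  using assms(3)
proof (induction k arbitrary: i)
  case 0
  then show ?case using d_le_weight assms by simp
next
  case (Suc k)
  then show ?case
    using best_response_contraction[OF iterate_profile[OF assms(1)] iterate_profile[OF assms(2)],
        of "\<beta> ^ k * 2" k k i] beta by (simp add: mult.assoc)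
qed

lemma geometric_null: "(\<lambda>k. \<beta> ^ k * 2 * w i) \<longlonglongrightarrow> 0"
proof -
  have "(\<lambda>k. \<beta> ^ k * (2 * w i)) \<longlonglongrightarrow> 0 * (2 * w i)"
    using beta by (intro tendsto_intros LIMSEQ_power_zero) auto
  then show ?thesis by (simp add: mult.assoc)
qed

lemma d_tendsto_0I:
  assumes "\<And>k. d i (x k) \<gamma> \<le> \<beta> ^ k * 2 * w i"
  shows "(\<lambda>k. d i (x k) \<gamma>) \<longlonglongrightarrow> 0"
  by (rule tendsto_sandwich[OF _ _ tendsto_const geometric_null[of i]]) (auto simp: assms d_nonneg)

lemma iterates_tendsto_fixed_point:
  assumes "\<gamma> \<in> \<Gamma>" "\<gamma>' \<in> \<Gamma>" "T \<gamma>' = \<gamma>'" "i < N"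
  shows "(\<lambda>k. d i ((T ^^ k) \<gamma>) \<gamma>') \<longlonglongrightarrow> 0"
proof (rule d_tendsto_0I)
  fix k
  have "(T ^^ k) \<gamma>' = \<gamma>'" by (induction k) (auto simp: assms(3))
  then show "d i ((T ^^ k) \<gamma>) \<gamma>' \<le> \<beta> ^ k * 2 * w i"
    using iterates_contract[OF assms(1,2,4), of k] by simp
qed

lemma fixed_point_unique:
  assumes "\<gamma> \<in> \<Gamma>" "\<gamma>' \<in> \<Gamma>" "T \<gamma> = \<gamma>" "T \<gamma>' = \<gamma>'"
  shows "\<gamma> = \<gamma>'"
proof (rule profile_eqI[OF assms(1,2)])
  fix i b a assume iba: "i < N" "b \<in> Y i" "a \<in> U i"
  have "(T ^^ k) \<gamma> = \<gamma>" for k by (induction k) (auto simp: assms(3))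
  then have "(\<lambda>k. \<gamma> i b a) \<longlonglongrightarrow> \<gamma>' i b a"
    using d_tendsto_0_imp_pointwise[OF iterates_tendsto_fixed_point[OF assms(1,2,4)] iba] by simp
  then show "\<gamma> i b a = \<gamma>' i b a" by (simp add: LIMSEQ_const_iff)
qed

text \<open>
Successive iterates approach each other geometrically, so every coordinate converges.  The limit
is a profile because the simplex is closed, and it is fixed because the best response operator is
Lipschitz continuous.
\<close>

lemma fixed_point_exists:
  assumes "\<gamma>0 \<in> \<Gamma>"
  obtains \<gamma> where "\<gamma> \<in> \<Gamma>" "T \<gamma> = \<gamma>"
proof -
  define x where "x k = (T ^^ k) \<gamma>0" for k
  have x: "x k \<in> \<Gamma>" for k unfolding x_def by (rule iterate_profile[OF assms])
  have step: "d i (x (Suc k)) (x k) \<le> \<beta> ^ k * 2 * w i" if "i < N" for i k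
    using iterates_contract[OF best_response_profile[OF assms] assms that, of k]
    by (simp add: x_def funpow_swap1)
  have conv: "convergent (\<lambda>k. x k i b a)" if iba: "i < N" "b \<in> Y i" "a \<in> U i" for i b a
  proof -
    have "summable (\<lambda>k. x (Suc k) i b a - x k i b a)"
    proof (rule summable_comparison_test')
      show "summable (\<lambda>k. real (card (Y i)) * (\<beta> ^ k * 2 * w i))"
        using beta by (intro summable_mult summable_mult2 summable_geometric) auto
      show "norm (x (Suc k) i b a - x k i b a) \<le> real (card (Y i)) * (\<beta> ^ k * 2 * w i)" for k
        using coordinate_le_d[OF iba, of "x (Suc k)" "x k"] step[OF iba(1), of k]
        by (smt (verit) mult_left_mono of_nat_0_le_iff real_norm_def)
    qed
    then have "convergent (\<lambda>n. \<Sum>k<n. x (Suc k) i b a - x k i b a)"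
      by (simp add: summable_iff_convergent)
    then have "convergent (\<lambda>n. x n i b a - x 0 i b a)"
      unfolding sum_lessThan_telescope[of "\<lambda>k. x k i b a"] .
    then show ?thesis using convergent_diff_const_right_iff by blast
  qed
  \<comment> \<open>Elements of \<open>distributions (U i)\<close> vanish outside \<open>U i\<close>, hence the value 0 there.\<close>
  define \<gamma> where "\<gamma> = (\<lambda>i\<in>{..<N}. \<lambda>b\<in>Y i. \<lambda>a. if a \<in> U i then lim (\<lambda>k. x k i b a) else 0)"
  have lim: "(\<lambda>k. x k i b a) \<longlonglongrightarrow> \<gamma> i b a" if "i < N" "b \<in> Y i" "a \<in> U i" for i b a
    using conv[OF that] that by (simp add: \<gamma>_def convergent_LIMSEQ_iff)
  have "\<gamma> i b \<in> distributions (U i)" if ib: "i < N" "b \<in> Y i" for i b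
  proof -
    note D = profile_distribution[OF x ib]
    have "0 \<le> \<gamma> i b a" if "a \<in> U i" for a
      using D that by (intro LIMSEQ_le_const[OF lim[OF ib that]]) (auto simp: distributions_def)
    moreover have "(\<lambda>k. \<Sum>a\<in>U i. x k i b a) \<longlonglongrightarrow> (\<Sum>a\<in>U i. \<gamma> i b a)"
      by (intro tendsto_sum lim ib)
    then have "(\<Sum>a\<in>U i. \<gamma> i b a) = 1"
      using D by (simp add: distributions_def LIMSEQ_const_iff)
    moreover have "\<gamma> i b \<in> vecs (U i)" using ib by (simp add: \<gamma>_def vecs_def)
    ultimately show ?thesis by (auto simp: distributions_def)
  qed
  then have G: "\<gamma> \<in> \<Gamma>"
    unfolding profiles_def policies_def by (auto simp: PiE_iff) (auto simp: \<gamma>_def)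
  have d_lim: "(\<lambda>k. d i (x k) \<gamma>) \<longlonglongrightarrow> 0" if "i < N" for i
  proof -
    have "(\<lambda>k. d i (x k) \<gamma>) \<longlonglongrightarrow> (\<Sum>b\<in>Y i. (\<Sum>a\<in>U i. \<bar>\<gamma> i b a - \<gamma> i b a\<bar>) * pmf (pmf_of_set (Y i)) b)"
      unfolding L1_norm_def l1_norm_def by (intro tendsto_intros lim that)
    then show ?thesis by simp
  qed
  have T_lim: "(\<lambda>k. d j (x (Suc k)) (T \<gamma>)) \<longlonglongrightarrow> 0" if j: "j < N" for j
  proof (rule tendsto_sandwich[OF _ _ tendsto_const])
    have "(\<lambda>k. \<Sum>i<N. influence j i * d i (x k) \<gamma>) \<longlonglongrightarrow> (\<Sum>i<N. influence j i * 0)"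
      by (intro tendsto_intros d_lim) auto
    then show "(\<lambda>k. \<Sum>i<N. influence j i * d i (x k) \<gamma>) \<longlonglongrightarrow> 0" by simp
    show "\<forall>\<^sub>F k in sequentially. d j (x (Suc k)) (T \<gamma>) \<le> (\<Sum>i<N. influence j i * d i (x k) \<gamma>)"
      using best_response_lipschitz[OF x G j] by (simp add: x_def)
  qed (simp add: d_nonneg)
  have "T \<gamma> = \<gamma>"
  proof (rule profile_eqI[OF best_response_profile[OF G] G])
    fix i b a assume iba: "i < N" "b \<in> Y i" "a \<in> U i"
    show "T \<gamma> i b a = \<gamma> i b a"
      using LIMSEQ_unique[OF d_tendsto_0_imp_pointwise[OF T_lim iba] LIMSEQ_Suc[OF lim[OF iba]]] .
  qed
  with G show ?thesis by (rule that)
qed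

text \<open>
While an agent responds, every other policy, updated or not, is within \<open>c * w i\<close> of the fixed
point, so the response is within \<open>\<beta> * c * w j\<close>.  A full sweep therefore contracts towards the fixed
point by the same factor \<open>\<beta>\<close> as a simultaneous update.
\<close>

lemma sweep_contraction:
  assumes "\<gamma> \<in> \<Gamma>" "\<gamma>' \<in> \<Gamma>" "T \<gamma>' = \<gamma>'" "0 \<le> c" "\<And>i. i < N \<Longrightarrow> d i \<gamma> \<gamma>' \<le> c * w i"
    and "m \<le> N" "i < N"
  shows "d i (sweep m \<gamma>) \<gamma>' \<le> (if i < m then \<beta> * c else c) * w i"
  using assms(6,7)
proof (induction m arbitrary: i)
  case 0
  then show ?case using assms by simp
next
  case (Suc m)
  show ?case
  proof (cases "i = m")
    case True
    have "d j (sweep m \<gamma>) \<gamma>' \<le> c * w j" if "j < N" for j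
    proof -
      have "\<beta> * c * w j \<le> 1 * c * w j"
        using beta assms(4) weight[OF that] by (intro mult_right_mono) auto
      then show ?thesis using Suc.IH[of j] Suc.prems that by (auto split: if_splits)
    qed
    then have "d m (T (sweep m \<gamma>)) (T \<gamma>') \<le> \<beta> * c * w m"
      using assms Suc.prems by (intro best_response_contraction sweep_profile) auto
    then show ?thesis using True assms(3) by simp
  next
    case False
    then show ?thesis using Suc.IH[of i] Suc.prems by (auto simp: less_Suc_eq)
  qed
qed

text \<open>
Iterated sweeps lead from \<open>\<gamma>\<close> to the fixed point without ever lowering the objective, and upper
semicontinuity at the fixed point bounds the objective along the way by its value there.
\<close>

lemma fixed_point_optimal:
  assumes "\<gamma> \<in> \<Gamma>" "\<gamma>' \<in> \<Gamma>" "T \<gamma>' = \<gamma>'"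
  shows "J \<gamma> \<le> J \<gamma>'"
proof -
  define x where "x k = (sweep N ^^ k) \<gamma>" for k
  have x: "x k \<in> \<Gamma>" for k
    unfolding x_def by (induction k) (auto simp: assms sweep_profile)
  show ?thesis
  proof (rule J_upper_semicontinuous_at_fixed_point[OF assms(2,3) x])
    show "J \<gamma> \<le> J (x k)" for k
    proof (induction k)
      case (Suc k)
      then show ?case using sweep_improves[OF x[of k], of N] by (simp add: x_def)
    qed (simp add: x_def)
  next
    fix i assume "i < N"
    show "(\<lambda>k. d i (x k) \<gamma>') \<longlonglongrightarrow> 0"
    proof (rule d_tendsto_0I)
      fix k
      show "d i (x k) \<gamma>' \<le> \<beta> ^ k * 2 * w i"
        using \<open>i < N\<close>
      proof (induction k arbitrary: i)
        case 0
        then show ?case using d_le_weight assms by (simp add: x_def)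
      next
        case (Suc k)
        then have "d i (sweep N (x k)) \<gamma>' \<le> (if i < N then \<beta> * (\<beta> ^ k * 2) else \<beta> ^ k * 2) * w i"
          using x assms beta by (intro sweep_contraction) auto
        then show ?case using Suc.prems by (simp add: x_def mult.assoc)
      qed
    qed
  qed
qed

end

theorem theorem1:
  fixes N :: nat
    and X :: "'x :: polish_space set"
    and Q :: "'x measure"
    and U :: "nat \<Rightarrow> 'u set"
    and Y :: "nat \<Rightarrow> 'y set"
    and W :: "nat \<Rightarrow> 'x \<times> (nat \<Rightarrow> 'u) \<Rightarrow> 'y measure"
    and p :: "'x \<Rightarrow> (nat \<Rightarrow> 'y) \<Rightarrow> (nat \<Rightarrow> 'u) \<Rightarrow> real"
    and r :: "(nat \<Rightarrow> 'y) \<Rightarrow> (nat \<Rightarrow> 'u) \<Rightarrow> real"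
    and \<rho> :: "nat \<Rightarrow> real"
    and \<Omega> :: "nat \<Rightarrow> ('u \<Rightarrow> real) \<Rightarrow> real"
    and \<gamma>0 :: "nat \<Rightarrow> 'y \<Rightarrow> 'u \<Rightarrow> real"
  assumes "N \<ge> 1"
    and "X \<in> sets borel"
    and "sets Q = sets (restrict_space borel X)"
    and "prob_space Q"
    and "\<And>i. i < N \<Longrightarrow> finite (U i) \<and> U i \<noteq> {}"
    and "\<And>i. i < N \<Longrightarrow> finite (Y i) \<and> Y i \<noteq> {}"
    and "\<And>i. i < N \<Longrightarrow>
           W i \<in> restrict_space borel X \<Otimes>\<^sub>M (\<Pi>\<^sub>M k\<in>{..<i}. count_space (U k))
                   \<rightarrow>\<^sub>M prob_algebra (count_space (Y i))"
    and "(\<lambda>(x, y, u). p x y u) \<in> borel_measurable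
           (restrict_space borel X \<Otimes>\<^sub>M (\<Pi>\<^sub>M i\<in>{..<N}. count_space (Y i))
              \<Otimes>\<^sub>M (\<Pi>\<^sub>M i\<in>{..<N}. count_space (U i)))"
    and "\<And>x y u. x \<in> X \<Longrightarrow> y \<in> PiE {..<N} Y \<Longrightarrow> u \<in> PiE {..<N} U \<Longrightarrow> 0 \<le> p x y u"
    and "\<And>y u. y \<in> PiE {..<N} Y \<Longrightarrow> u \<in> PiE {..<N} U \<Longrightarrow>
           integrable Q (reward_integrand N Y W p y u)"
    and "r = reward Q N Y W p"
    and "\<And>i. i < N \<Longrightarrow> 0 < \<rho> i"
    and "\<And>i. i < N \<Longrightarrow> convex_on_distributions (U i) (\<Omega> i)"
    and "\<And>i. i < N \<Longrightarrow> strongly_convex (U i) (\<rho> i) (\<Omega> i)"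
    and "\<And>j g b. j < N \<Longrightarrow> g \<in> profiles ({..<N} - {j}) U Y \<Longrightarrow> b \<in> Y j \<Longrightarrow>
           \<exists>!\<delta>. is_arg_max (response_objective N U Y r \<Omega> j g b) (\<lambda>\<delta>. \<delta> \<in> distributions (U j)) \<delta>"
    and "spectral_radius (P_matrix N U Y r \<rho>) < 1"
    and "\<gamma>0 \<in> profiles {..<N} U Y"
  shows "\<exists>\<gamma>s \<in> profiles {..<N} U Y.
           best_response_operator N U Y r \<Omega> \<gamma>s = \<gamma>s
         \<and> (\<forall>\<gamma> \<in> profiles {..<N} U Y. best_response_operator N U Y r \<Omega> \<gamma> = \<gamma> \<longrightarrow> \<gamma> = \<gamma>s)
         \<and> (\<forall>i<N. (\<lambda>k. L1_norm (U i) (Y i)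
                (\<lambda>b a. (best_response_operator N U Y r \<Omega> ^^ k) \<gamma>0 i b a - \<gamma>s i b a)) \<longlonglongrightarrow> 0)
         \<and> ereal (J_reg N U Y r \<Omega> \<gamma>s) = (SUP \<gamma>\<in>profiles {..<N} U Y. ereal (J_reg N U Y r \<Omega> \<gamma>))"
proof -
  interpret regularized_team N U Y r \<rho> \<Omega>
    using assms(5,6,12,14,15) by unfold_locales blast+
  have P: "P_matrix N U Y r \<rho> = mat N N (\<lambda>(j, i). complex_of_real (influence j i))"
    unfolding P_matrix_def influence_def by (intro cong_mat) auto
  have "0 < N" "spectral_radius (mat N N (\<lambda>(j, i). complex_of_real (influence j i))) < 1"
    using assms(1,16) unfolding P by auto
  then obtain w \<beta> where w: "0 < \<beta>" "\<beta> < 1" "\<And>i. i < N \<Longrightarrow> 1 \<le> w i"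
      "\<And>j. j < N \<Longrightarrow> (\<Sum>i<N. influence j i * w i) \<le> \<beta> * w j"
    by (rule subinvariant_weights) (blast intro: influence_nonneg)+
  interpret contractive_team N U Y r \<rho> \<Omega> w \<beta>
    by unfold_locales (use w in auto)
  obtain \<gamma>s where s: "\<gamma>s \<in> \<Gamma>" "T \<gamma>s = \<gamma>s"
    using fixed_point_exists[OF assms(17)] .
  have "ereal (J \<gamma>s) = (SUP \<gamma>\<in>\<Gamma>. ereal (J \<gamma>))"
    using s fixed_point_optimal by (intro antisym SUP_upper SUP_least) auto
  moreover have "\<forall>\<gamma>\<in>\<Gamma>. T \<gamma> = \<gamma> \<longrightarrow> \<gamma> = \<gamma>s"
    using fixed_point_unique[OF _ s(1) _ s(2)] by blast
  moreover have "\<forall>i<N. (\<lambda>k. d i ((T ^^ k) \<gamma>0) \<gamma>s) \<longlonglongrightarrow> 0"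
    using iterates_tendsto_fixed_point[OF assms(17) s] by blast
  ultimately show ?thesis using s by blast
qed

end
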